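(* For each $0<\rho<1$ there exist finite positive constants $\delta_0(\rho), C(\rho), N_0(\rho)$ such that for all $N\ge N_0(\rho)$ and $N^{-2/3}\le\delta\le\delta_0(\rho)$, $$\mathbb{P}^\rho\big\{\text{there exists } z \text{ outside } [\![0,v_N]\!]\text{ such that } |\mathbf{Z}^{0\to z}|\le\delta N^{2/3}\big\}\;\ge\; C(\rho)\,\delta .$$
   Context: Notation: $e_1=(1,0)$, $e_2=(0,1)$; points of $\mathbb{Z}^2$ are ordered coordinatewise, $|x|_1=|x_1|+|x_2|$; $[\![a,b]\!]=\{x\in\mathbb{Z}^2:a\le x\le b\}$; $\mathrm{Exp}(\alpha)$ is the exponential distribution of rate $\alpha$. For $\rho\in(0,1)$ and a real scaling parameter $N>0$, $v_N=(\lfloor N(1-\rho)^2\rfloor,\lfloor N\rho^2\rfloor)$. Stationary last-passage percolation with base point $0$ and parameter $\rho$: under $\mathbb{P}^\rho$ the following weights are mutually independent: bulk weights $\omega_z\sim\mathrm{Exp}(1)$ for $z\in\mathbb{Z}_{>0}^2$, and boundary weights $I_{ke_1}\sim\mathrm{Exp}(1-\rho)$, $J_{le_2}\sim\mathrm{Exp}(\rho)$ for $k,l\in\mathbb{Z}_{>0}$. For $x\le y$ in $\mathbb{Z}_{>0}^2$, $G_{x,y}$ is the maximum of $\sum_{k=0}^{|y-x|_1}\omega_{z_k}$ over paths from $x$ to $y$ with steps in $\{e_1,e_2\}$. For $y=(m,n)\in\mathbb{Z}_{>0}^2$, $$G^\rho_{0,y}=\max_{1\le k\le m}\Big\{\sum_{i=1}^kI_{ie_1}+G_{ke_1+e_2,y}\Big\}\vee\max_{1\le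 l\le n}\Big\{\sum_{j=1}^lJ_{je_2}+G_{le_2+e_1,y}\Big\}.$$ The maximizer is almost surely unique. The exit time $\mathbf{Z}^{0\to y}\in\mathbb{Z}\setminus\{0\}$ is $k>0$ if the maximum is attained at the term $\sum_{i=1}^kI_{ie_1}+G_{ke_1+e_2,y}$, and $-l<0$ if it is attained at the term $\sum_{j=1}^lJ_{je_2}+G_{le_2+e_1,y}$. Points $z$ "outside $[\![0,v_N]\!]$" range over $\mathbb{Z}_{>0}^2\setminus[\![0,v_N]\!]$, where the exit time is defined. *)

theory Defs
  imports "HOL-Probability.Probability"
begin

text \<open>
  Points of the lattice are of type \<^typ>\<open>int \<times> int\<close>; with the library's product order,
  \<open>\<le>\<close> is coordinatewise and \<open>{a..b}\<close> is the lattice rectangle with corners \<open>a\<close> and \<open>b\<close>.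
\<close>

definition e1 :: "int \<times> int" where "e1 = (1, 0)"
definition e2 :: "int \<times> int" where "e2 = (0, 1)"

definition bulk :: "(int \<times> int) set" where
  "bulk = {(a, b). a > 0 \<and> b > 0}"

definition axis1 :: "(int \<times> int) set" where
  "axis1 = {(k, 0) | k. k > 0}"

definition axis2 :: "(int \<times> int) set" where
  "axis2 = {(0, l) | l. l > 0}"

text \<open>
  The three families of weights are bundled into one family indexed by lattice sites:
  \<open>W (k, l)\<close> is the bulk weight, \<open>W (k, 0)\<close> is the weight \<open>I\<close> at \<open>k e1\<close> and
  \<open>W (0, l)\<close> is the weight \<open>J\<close> at \<open>l e2\<close>, where \<open>k, l > 0\<close>. The values of \<open>W\<close> at all other
  sites are unconstrained and never used.
\<close>

definition stationary_weights ::
    "'a measure \<Rightarrow> real \<Rightarrow> (int \<times> int \<Rightarrow> 'a \<Rightarrow> real) \<Rightarrow> bool" where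
  "stationary_weights P \<rho> W \<longleftrightarrow>
     prob_space P \<and>
     prob_space.indep_vars P (\<lambda>_. borel) W (bulk \<union> axis1 \<union> axis2) \<and>
     (\<forall>z\<in>bulk. distributed P lborel (W z) (exponential_density 1)) \<and>
     (\<forall>z\<in>axis1. distributed P lborel (W z) (exponential_density (1 - \<rho>))) \<and>
     (\<forall>z\<in>axis2. distributed P lborel (W z) (exponential_density \<rho>))"

definition paths :: "int \<times> int \<Rightarrow> int \<times> int \<Rightarrow> (int \<times> int) list set" where
  "paths x y = {p. p \<noteq> [] \<and> hd p = x \<and> last p = y \<and> successively (\<lambda>u v. v - u \<in> {e1, e2}) p}"

definition lpp :: "(int \<times> int \<Rightarrow> real) \<Rightarrow> int \<times> int \<Rightarrow> int \<times> int \<Rightarrow> real" where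
  "lpp w x y = Max ((\<lambda>p. \<Sum>z\<leftarrow>p. w z) ` paths x y)"

text \<open>The term of index \<open>k \<noteq> 0\<close> in the maximum defining the stationary passage time,
  negative indices standing for exits from the vertical axis.\<close>

definition exit_term :: "(int \<times> int \<Rightarrow> real) \<Rightarrow> int \<times> int \<Rightarrow> int \<Rightarrow> real" where
  "exit_term w y k =
     (if k > 0 then (\<Sum>i=1..k. w (i, 0)) + lpp w (k, 1) y
      else (\<Sum>j=1..-k. w (0, j)) + lpp w (1, -k) y)"

definition stat_lpp :: "(int \<times> int \<Rightarrow> real) \<Rightarrow> int \<times> int \<Rightarrow> real" where
  "stat_lpp w y =
     max (MAX k\<in>{1..fst y}. exit_term w y k) (MAX l\<in>{1..snd y}. exit_term w y (-l))"

text \<open>The maximizer is almost surely unique, so that the choice made here only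
  matters on a null event.\<close>

definition exit_time :: "(int \<times> int \<Rightarrow> real) \<Rightarrow> int \<times> int \<Rightarrow> int" where
  "exit_time w y =
     (SOME k. k \<in> {- snd y..fst y} - {0} \<and> exit_term w y k = stat_lpp w y)"

definition vN :: "real \<Rightarrow> real \<Rightarrow> int \<times> int" where
  "vN \<rho> N = (\<lfloor>N * (1 - \<rho>)\<^sup>2\<rfloor>, \<lfloor>N * \<rho>\<^sup>2\<rfloor>)"

end

theory Submission
  imports Defs
begin

text \<open>
  The event follows by a counting argument from one estimate: if \<open>z\<close> lies just beyond \<open>v\<^sub>N\<close>,
  then with probability at least \<open>1/2\<close> the path to \<open>z\<close> leaves the axes within \<open>O(N\<^bsup>2/3\<^esup>)\<close> of the
  origin.

  Cut this window into \<open>O(1/\<delta>)\<close> blocks of length \<open>\<delta> N\<^bsup>2/3\<^esup>\<close>. By Burke's theorem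
  (\<open>stationary_shift\<close>) the increments of the passage time along a vertical line are again
  independent exponentials of rate \<open>\<rho>\<close>, independent of the weights to the right of the line. Hence the
  base point may be moved along the axis to the start of a block without changing the law of the
  model, and an exit in the block becomes an exit at distance at most \<open>\<delta> N\<^bsup>2/3\<^esup>\<close> from the new base
  point. The endpoint is only translated along the direction of the axis, so that its other
  coordinate keeps it outside the rectangle. Every block therefore has at most the probability
  \<open>p\<close> of the event in question, and \<open>1/2 \<le> O(1/\<delta>) p\<close>.

  The estimate on the window comes from exponential moments in a single stationary model. Write
  \<open>G\<close> for the stationary passage time to \<open>(m, n)\<close>, \<open>G(0, n)\<close> for the sum of the first \<open>n\<close> vertical
  boundary weights, and \<open>A\<close> for the best passage time among the paths that leave through the
  horizontal axis. \<open>A\<close> is independent of the vertical boundary weights and \<open>A \<le> G\<close>, hence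
  \<open>E exp(tA) \<cdot> E exp(-t G(0, n)) \<le> E exp(t(G - G(0, n)))\<close>; the second factor is explicit, and so is
  the right-hand side, because \<open>G - G(0, n)\<close> is a sum of \<open>m\<close> independent exponentials by Burke's
  theorem. For \<open>t = N\<^bsup>-1/3\<^esup>\<close> in the characteristic direction the quadratic terms in \<open>t\<close> cancel up to
  \<open>O(1)\<close>, and the bound is \<open>exp(t E G + O(1))\<close>. The same holds for vertical exits, so
  \<open>E exp(t(G - E G)) = O(1)\<close>; since \<open>G - E G\<close> is centred, this also controls its lower tail.

  If the path exits beyond \<open>k = r N\<^bsup>2/3\<^esup>\<close>, then \<open>G = S + A'\<close> with \<open>S\<close> the sum of the first \<open>k\<close>
  boundary weights and \<open>A'\<close> the horizontal passage time from the base point \<open>(k, 0)\<close>. Seen from there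
  the endpoint is off the characteristic direction, and the quadratic terms leave a factor
  \<open>exp(-t\<^sup>2 k / (2(1 - \<rho>)\<^sup>2)) = exp(-c r)\<close> in the moment bound for \<open>A'\<close>. So \<open>A'\<close> falls short by order
  \<open>r N\<^bsup>1/3\<^esup>\<close>, which neither the fluctuations of \<open>S\<close>, of order \<open>\<surd>r N\<^bsup>1/3\<^esup>\<close>, nor the lower tail of
  \<open>G\<close> can compensate when \<open>r\<close> is large.
\<close>

section \<open>Passage times by recursion, and the shift of the base point\<close>

text \<open>
  The stationary passage time, with values on the axes included. The recursion
  determines it from the weights, which makes a change of base point a one-line induction, whereas the
  maximum over exit points has no value on the axes.
\<close>
fun passage :: "(int \<times> int \<Rightarrow> real) \<Rightarrow> nat \<Rightarrow> nat \<Rightarrow> real" where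
  "passage w 0 0 = 0"
| "passage w (Suc i) 0 = passage w i 0 + w (int (Suc i), 0)"
| "passage w 0 (Suc j) = passage w 0 j + w (0, int (Suc j))"
| "passage w (Suc i) (Suc j) =
     w (int (Suc i), int (Suc j)) + max (passage w i (Suc j)) (passage w (Suc i) j)"

definition flip :: "(int \<times> int \<Rightarrow> 'b) \<Rightarrow> int \<times> int \<Rightarrow> 'b" where
  "flip w z = w (prod.swap z)"

text \<open>
  The weights seen from the base point \<open>e1\<close>: the new vertical boundary weights are the increments
  of the passage time along the line through \<open>e1\<close>, so that passage times from the new base point are
  differences of old ones.
\<close>
definition shift :: "(int \<times> int \<Rightarrow> real) \<Rightarrow> int \<times> int \<Rightarrow> real" where
  "shift w z = (if fst z = 0 then passage w 1 (nat (snd z)) - passage w 1 (nat (snd z - 1))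
                else w (z + e1))"

text \<open>
  Keeping all maximizers, rather than the chosen one, makes the notion compatible with
  \<open>flip\<close> and \<open>shift\<close>; ties are excluded almost surely later.
\<close>
definition exits :: "(int \<times> int \<Rightarrow> real) \<Rightarrow> int \<times> int \<Rightarrow> int \<Rightarrow> bool" where
  "exits w y k \<longleftrightarrow> k \<in> {- snd y..fst y} - {0} \<and> exit_term w y k = stat_lpp w y"

lemma flip_flip [simp]: "flip (flip w) = w"
  by (simp add: flip_def fun_eq_iff)

lemma flip_apply [simp]: "flip w (a, b) = w (b, a)"
  by (simp add: flip_def)

lemma passage_flip: "passage (flip w) i j = passage w j i"
  by (induction w j i rule: passage.induct) (auto simp: max.commute)

lemma passage_row: "passage w k 0 = (\<Sum>i=1..k. w (int i, 0))"
  by (induction k) auto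

lemma passage_col: "passage w 0 k = (\<Sum>i=1..k. w (0, int i))"
  by (induction k) auto

text \<open>
  The new boundary values telescope to the increments of the old passage time, and in the bulk
  the recursion commutes with subtracting a constant.
\<close>
lemma passage_shift: "passage (shift w) i j = passage w (Suc i) j - passage w 1 0"
proof (induction w i j rule: passage.induct)
  case (2 w i) then show ?case by (simp add: shift_def e1_def)
next
  case (3 w j)
  then show ?case
    by (simp add: shift_def e1_def nat_add_distrib del: passage.simps One_nat_def of_nat_Suc of_nat_add)
       (simp add: nat_add_distrib)
next
  case (4 w i j) then show ?case by (simp add: shift_def e1_def max_def)
qed auto

lemma passage_shift_iter: "passage ((shift ^^ k) w) i j = passage w (i + k) j - passage w k 0"
proof (induction k arbitrary: i j)
  case (Suc k)
  have "passage ((shift ^^ Suc k) w) i j = passage ((shift ^^ k) w) (Suc i) j - passage ((shift ^^ k) w) 1 0"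
    unfolding funpow.simps o_apply by (rule passage_shift)
  then show ?case by (simp add: Suc del: passage.simps)
qed simp

lemma sum_int_nat: "(\<Sum>i=1..int k. f i) = (\<Sum>i=1..k. f (int i))"
  by (rule sum.reindex_bij_witness[where i=int and j=nat]) auto

lemma paths_Cons:
  "x # q \<in> paths a y \<longleftrightarrow>
     a = x \<and> (q = [] \<and> x = y \<or> (\<exists>x'. x' - x \<in> {e1, e2} \<and> q \<in> paths x' y))"
  by (cases q) (auto simp: paths_def)

lemma paths_not_Nil: "[] \<notin> paths x y"
  by (simp add: paths_def)

lemma paths_refl: "paths x x \<noteq> {}" by (auto simp: paths_def intro!: exI[of _ "[x]"])

lemma paths_bounds:
  assumes "p \<in> paths x y"
  shows "set p \<subseteq> {x..y}" "int (length p) = fst y + snd y - fst x - snd x + 1"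
  using assms
proof (induction p arbitrary: x)
  case (Cons a q)
  { case 1
    then consider "x = a" "q = []" "x = y"
      | x' where "x = a" "x' = x + e1 \<or> x' = x + e2" "q \<in> paths x' y"
      by (auto simp: paths_Cons diff_eq_eq add.commute)
    then show ?case
    proof cases
      case 2
      then have s: "set q \<subseteq> {x'..y}" using Cons(1) by blast
      have "x \<le> x'" using 2 by (cases x) (auto simp: e1_def e2_def)
      have "q \<noteq> []" using 2 paths_not_Nil by blast
      then have "x' \<le> y" using s by (cases q) auto
      moreover have "x \<le> z" "z \<le> y" if "z \<in> set q" for z
        using that s order.trans[OF \<open>x \<le> x'\<close>, of z] by auto
      moreover have "x \<le> y" using \<open>x \<le> x'\<close> \<open>x' \<le> y\<close> by (rule order.trans)
      ultimately show ?thesis using 2(1) by (simp add: subset_iff)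
    qed auto }
  { case 2 then show ?case using Cons(2)
      by (fastforce simp: paths_Cons e1_def e2_def prod_eq_iff) }
qed (auto simp: paths_def)

lemma finite_rectangle: "finite {x..y :: int \<times> int}"
  by (rule finite_subset[of _ "{fst x..fst y} \<times> {snd x..snd y}"])
     (auto simp: less_eq_prod_def)

lemma finite_paths: "finite (paths x y)"
  by (rule finite_subset[OF _ finite_lists_length_eq[OF finite_rectangle[of x y],
      of "nat (fst y + snd y - fst x - snd x + 1)"]])
     (auto dest: paths_bounds)

lemma paths_snoc:
  "p \<in> paths x y \<Longrightarrow> y' - y \<in> {e1, e2} \<Longrightarrow> p @ [y'] \<in> paths x y'"
  by (auto simp: paths_def successively_append_iff)

lemma paths_nonempty:
  assumes "x \<le> y" shows "paths x y \<noteq> {}"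
  using assms
proof (induction "nat (fst y + snd y - fst x - snd x)" arbitrary: y rule: less_induct)
  case less
  show ?case
  proof (cases "x = y")
    case False
    obtain a b c d where xy: "x = (a,b)" "y = (c,d)" by (cases x, cases y)
    define y0 where "y0 = (if a < c then (c - 1, d) else (c, d - 1))"
    have "x \<le> y0" "nat (fst y0 + snd y0 - fst x - snd x) < nat (fst y + snd y - fst x - snd x)"
      "y - y0 \<in> {e1, e2}"
      using less.prems False by (auto simp: y0_def xy e1_def e2_def)
    then show ?thesis using less.hyps paths_snoc by blast
  qed (simp add: paths_refl)
qed

lemma lpp_ge: "p \<in> paths x y \<Longrightarrow> (\<Sum>z\<leftarrow>p. w z) \<le> lpp w x y"
  unfolding lpp_def by (intro Max_ge) (auto simp: finite_paths)

lemma lpp_attained: "x \<le> y \<Longrightarrow> \<exists>p\<in>paths x y. lpp w x y = (\<Sum>z\<leftarrow>p. w z)"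
  using Max_in[of "(\<lambda>p. \<Sum>z\<leftarrow>p. w z) ` paths x y"] paths_nonempty[of x y] finite_paths[of x y]
  unfolding lpp_def by blast

lemma lpp_refl: "lpp w x x = w x"
proof -
  have "p = [x]" if "p \<in> paths x x" for p
  proof -
    have "length p = 1" using paths_bounds(2)[OF that] by simp
    then show ?thesis using that by (auto simp: paths_def length_Suc_conv)
  qed
  then have "paths x x = {[x]}" using paths_refl by blast
  then show ?thesis by (simp add: lpp_def)
qed

lemma lpp_step:
  assumes "x \<le> y" "y' - y \<in> {e1, e2}" shows "lpp w x y + w y' \<le> lpp w x y'"
proof -
  obtain p where "p \<in> paths x y" "lpp w x y = (\<Sum>z\<leftarrow>p. w z)" using lpp_attained[OF assms(1)] by blast
  then show ?thesis using lpp_ge[OF paths_snoc[OF _ assms(2)], of p x w] by simp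
qed

text \<open>
  Both symmetries of the model, the translation by \<open>e1\<close> and the reflection in the
  diagonal, act on last-passage times through this lemma.
\<close>
lemma lpp_reindex:
  assumes inv: "\<And>z. g (f z) = z" "\<And>z. f (g z) = z"
    and step: "\<And>u v. f v - f u \<in> {e1, e2} \<longleftrightarrow> v - u \<in> {e1, e2}"
    and eq: "\<And>z. z \<in> {x..y} \<Longrightarrow> w' z = w (f z)"
  shows "lpp w' x y = lpp w (f x) (f y)"
proof -
  have sub: "map f p \<in> paths (f x) (f y)" if "p \<in> paths x y" for p
    using that by (auto simp: paths_def successively_map hd_map last_map step[simplified])
  have inj: "f u = f v \<longleftrightarrow> u = v" for u v using inv by metis
  have sup: "p \<in> map f ` paths x y" if p: "p \<in> paths (f x) (f y)" for p
  proof (rule image_eqI)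
    show e: "p = map f (map g p)" by (simp add: inv comp_def)
    have "map f (map g p) \<in> paths (f x) (f y)" using p e by simp
    then show "map g p \<in> paths x y"
      unfolding paths_def by (auto simp del: map_map simp: successively_map hd_map last_map inv step[simplified])
  qed
  have "paths (f x) (f y) = map f ` paths x y" using sub sup by blast
  moreover have "(\<Sum>z\<leftarrow>p. w' z) = (\<Sum>z\<leftarrow>map f p. w z)" if "p \<in> paths x y" for p
    using paths_bounds(1)[OF that] eq
    by (auto simp: comp_def intro!: arg_cong[of _ _ sum_list] map_cong)
  ultimately show ?thesis
    by (simp add: lpp_def image_image cong: image_cong)
qed

lemma lpp_flip: "lpp (flip w) x y = lpp w (prod.swap x) (prod.swap y)"
  by (rule lpp_reindex[where g=prod.swap]) (auto simp: flip_def e1_def e2_def prod_eq_iff)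

lemma exit_term_flip:
  "k \<noteq> 0 \<Longrightarrow> exit_term (flip w) (prod.swap y) (- k) = exit_term w y k"
  by (simp add: exit_term_def lpp_flip)

lemma exit_term_row:
  "1 \<le> k \<Longrightarrow> exit_term w y (int k) = passage w k 0 + lpp w (int k, 1) y"
  by (simp add: exit_term_def passage_row sum_int_nat)

text \<open>
  Each step of a path can lose, but never gain, against the maximum in the recursion. The
  constant \<open>c\<close> stands for what has been collected before the path starts at \<open>(a + 1, b + 1)\<close>.
\<close>
lemma passage_path:
  assumes "p \<in> paths (int (Suc a), int (Suc b)) (int m, int n)"
    and "c \<le> max (passage w a (Suc b)) (passage w (Suc a) b)"
  shows "c + (\<Sum>z\<leftarrow>p. w z) \<le> passage w m n"
  using assms
proof (induction p arbitrary: a b c)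
  case (Cons x q)
  have x: "x = (int (Suc a), int (Suc b))" using Cons.prems by (auto simp: paths_Cons)
  have c: "c + w x \<le> passage w (Suc a) (Suc b)" using Cons.prems x by simp
  from Cons.prems(1) consider "q = []" "(int (Suc a), int (Suc b)) = (int m, int n)"
    | "q \<in> paths (x + e1) (int m, int n)" | "q \<in> paths (x + e2) (int m, int n)"
    unfolding paths_Cons by (auto simp: x diff_eq_eq add.commute)
  then show ?case
  proof cases
    case 1 then show ?thesis using c by (auto simp del: of_nat_Suc)
  next
    case 2
    then have "c + w x + (\<Sum>z\<leftarrow>q. w z) \<le> passage w m n"
      using Cons.IH[of "Suc a" b "c + w x"] c by (simp add: x e1_def add.commute)
    then show ?thesis by simp
  next
    case 3
    then have "c + w x + (\<Sum>z\<leftarrow>q. w z) \<le> passage w m n"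
      using Cons.IH[of a "Suc b" "c + w x"] c by (simp add: x e2_def add.commute)
    then show ?thesis by simp
  qed
qed (simp add: paths_not_Nil)

lemma exit_term_le_passage:
  assumes "1 \<le> k" "k \<le> m" "1 \<le> n"
  shows "exit_term w (int m, int n) (int k) \<le> passage w m n"
proof -
  obtain p where p: "p \<in> paths (int k, 1) (int m, int n)"
      "lpp w (int k, 1) (int m, int n) = (\<Sum>z\<leftarrow>p. w z)"
    using lpp_attained[of "(int k, 1)" "(int m, int n)"] assms by auto
  obtain a where a: "k = Suc a" using assms by (cases k) auto
  show ?thesis
    using passage_path[of p a 0 m n "passage w k 0" w] p assms a exit_term_row[of k w "(int m, int n)"]
    by (simp add: max.coboundedI2)
qed

lemma exit_term_neg_le_passage:
  assumes "1 \<le> k" "k \<le> n" "1 \<le> m"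
  shows "exit_term w (int m, int n) (- int k) \<le> passage w m n"
  using exit_term_le_passage[of k n m "flip w"] assms
    exit_term_flip[of "- int k" w "(int m, int n)"] by (simp add: passage_flip)

lemma exit_term_step:
  assumes "y' - y \<in> {e1, e2}" "y \<in> bulk" "k \<in> {- snd y..fst y} - {0}"
  shows "exit_term w y k + w y' \<le> exit_term w y' k"
  using assms lpp_step[of "(k, 1)" y y' w] lpp_step[of "(1, -k)" y y' w]
  by (cases y) (auto simp: exit_term_def bulk_def)

text \<open>
  Following the larger predecessor in the recursion leads back to one of the axes; the point where
  the axis is met is an exit point that realizes the value.
\<close>
lemma passage_attained:
  "\<exists>k\<in>{- int (Suc n)..int (Suc m)} - {0}.
      passage w (Suc m) (Suc n) \<le> exit_term w (int (Suc m), int (Suc n)) k"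
proof (induction "m + n" arbitrary: m n rule: less_induct)
  case less
  let ?y = "(int (Suc m), int (Suc n))"
  consider "passage w (Suc m) (Suc n) = w ?y + passage w m (Suc n)"
    | "passage w (Suc m) (Suc n) = w ?y + passage w (Suc m) n" by (metis max_def passage.simps(4))
  then show ?case
  proof cases
    case 1
    show ?thesis
    proof (cases m)
      case 0
      have "exit_term w ?y (- int (Suc n)) =
          (\<Sum>j=1..int (Suc n). w (0, j)) + lpp w (1, int (Suc n)) (1, int (Suc n))"
        using 0
        by (simp add: exit_term_def add.commute)
      also have "\<dots> = passage w 0 (Suc n) + w ?y"
        unfolding sum_int_nat lpp_refl passage_col by (simp add: 0)
      finally have "exit_term w ?y (- int (Suc n)) = passage w 0 (Suc n) + w ?y" .
      then show ?thesis using 1 0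
        by (intro bexI[of _ "- int (Suc n)"]) (auto simp del: passage.simps)
    next
      case (Suc m')
      then have "m' + n < m + n" by simp
      from less[OF this, folded Suc] obtain k where k: "k\<in>{- int (Suc n)..int m} - {0}"
        "passage w m (Suc n) \<le> exit_term w (int m, int (Suc n)) k"
        by blast
      have "exit_term w (int m, int (Suc n)) k + w ?y \<le> exit_term w ?y k"
        by (rule exit_term_step) (use k Suc in \<open>auto simp: e1_def bulk_def\<close>)
      then show ?thesis using 1 k by (intro bexI[of _ k]) (auto simp del: passage.simps)
    qed
  next
    case 2
    show ?thesis
    proof (cases n)
      case 0
      have "exit_term w ?y (int (Suc m)) = passage w (Suc m) 0 + w ?y"
        by (simp add: exit_term_row 0 lpp_refl del: passage.simps of_nat_Suc) (simp add: lpp_refl)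
      then show ?thesis using 2 0
        by (intro bexI[of _ "int (Suc m)"]) (auto simp del: passage.simps)
    next
      case (Suc n')
      then have "m + n' < m + n" by simp
      from less[OF this, folded Suc] obtain k where k: "k\<in>{- int n..int (Suc m)} - {0}"
        "passage w (Suc m) n \<le> exit_term w (int (Suc m), int n) k"
        by blast
      have "exit_term w (int (Suc m), int n) k + w ?y \<le> exit_term w ?y k"
        by (rule exit_term_step) (use k Suc in \<open>auto simp: e2_def bulk_def\<close>)
      then show ?thesis using 2 k by (intro bexI[of _ k]) (auto simp del: passage.simps)
    qed
  qed
qed

lemma passage_attained_by_exit:
  assumes "1 \<le> m" "1 \<le> n"
  shows "\<exists>k\<in>{- int n..int m} - {0}. passage w m n \<le> exit_term w (int m, int n) k"
proof -
  have "Suc (n - 1) = n" "Suc (m - 1) = m" using assms by auto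
  then show ?thesis using passage_attained[of "n-1" "m-1" w] by simp
qed

lemma exit_term_le:
  assumes "1 \<le> m" "1 \<le> n" "k \<in> {- int n..int m} - {0}"
  shows "exit_term w (int m, int n) k \<le> passage w m n"
proof (cases "k > 0")
  case True
  then show ?thesis using exit_term_le_passage[of "nat k" m n w] assms by auto
next
  case False
  then show ?thesis using exit_term_neg_le_passage[of "nat (-k)" n m w] assms by auto
qed

lemma stat_lpp_eq_passage:
  assumes "1 \<le> m" "1 \<le> n"
  shows "stat_lpp w (int m, int n) = passage w m n"
proof -
  let ?A = "(\<lambda>k. exit_term w (int m, int n) k) ` {1..int m}"
  let ?B = "(\<lambda>k. exit_term w (int m, int n) (-k)) ` {1..int n}"
  have "Max ?A \<le> passage w m n" "Max ?B \<le> passage w m n"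
    using assms by (auto intro!: exit_term_le)
  moreover obtain k where k: "k\<in>{- int n..int m} - {0}"
      "passage w m n \<le> exit_term w (int m, int n) k"
    using passage_attained_by_exit[OF assms] by blast
  moreover have "exit_term w (int m, int n) k \<le> Max ?A" if "k > 0"
    using that k by (intro Max_ge) auto
  moreover have "exit_term w (int m, int n) k \<le> Max ?B" if "k < 0"
    using that k by (intro Max_ge) (auto intro!: image_eqI[of _ _ "-k"])
  ultimately show ?thesis unfolding stat_lpp_def by fastforce
qed

lemma exits_iff:
  assumes "1 \<le> m" "1 \<le> n"
  shows "exits w (int m, int n) k \<longleftrightarrow>
    k \<in> {- int n..int m} - {0} \<and> exit_term w (int m, int n) k = passage w m n"
  using assms by (simp add: exits_def stat_lpp_eq_passage)

lemma exits_exists: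
  assumes "1 \<le> m" "1 \<le> n" shows "\<exists>k. exits w (int m, int n) k"
proof -
  obtain k where "k\<in>{- int n..int m} - {0}" "passage w m n \<le> exit_term w (int m, int n) k"
    using passage_attained_by_exit[OF assms] by blast
  then show ?thesis
    using exit_term_le[OF assms, of k w] unfolding exits_iff[OF assms] by (auto intro!: exI[of _ k] antisym)
qed

lemma exits_flip:
  assumes "1 \<le> m" "1 \<le> n"
  shows "exits (flip w) (int n, int m) (- k) \<longleftrightarrow> exits w (int m, int n) k"
  using assms exit_term_flip[of k w "(int m, int n)"] by (auto simp: exits_iff passage_flip)

text \<open>
  An exit beyond the new base point is still optimal there: the passage time and the exit
  term both drop by the weight of the first boundary site.
\<close>
lemma exits_shift:
  assumes "1 \<le> m" "1 \<le> n" "1 \<le> j" "exits w (int (Suc m), int n) (int (Suc j))"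
  shows "exits (shift w) (int m, int n) (int j)"
proof -
  have "lpp (shift w) (int j, 1) (int m, int n) = lpp w ((int j, 1) + e1) ((int m, int n) + e1)"
    by (rule lpp_reindex[where f="\<lambda>z. z + e1" and g="\<lambda>z. z - e1"])
       (use assms in \<open>auto simp: shift_def less_eq_prod_def\<close>)
  moreover have "(int j, 1) + e1 = (int (Suc j), 1)" "(int m, int n) + e1 = (int (Suc m), int n)"
    by (auto simp: e1_def)
  ultimately show ?thesis using assms
    by (auto simp: exits_iff exit_term_row passage_shift simp del: of_nat_Suc passage.simps)
qed

lemma exits_shift_iter:
  assumes "1 \<le> n" "k < j" "exits w (int m, int n) (int j)"
  shows "exits ((shift ^^ k) w) (int (m - k), int n) (int (j - k))" "k < m"
proof -
  have "j \<le> m" using assms exits_def[of w "(int m, int n)" "int j"] by auto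
  then show "k < m" using assms by simp
  have "exits ((shift ^^ i) w) (int (m - i), int n) (int (j - i))" if "i \<le> k" for i
    using that
  proof (induction i)
    case (Suc i)
    then show ?case
      using exits_shift[of "m - Suc i" n "j - Suc i" "(shift ^^ i) w"] assms \<open>j \<le> m\<close>
      by (auto simp: Suc_diff_Suc simp del: of_nat_diff of_nat_Suc)
  qed (use assms in simp)
  then show "exits ((shift ^^ k) w) (int (m - k), int n) (int (j - k))" by simp
qed

text \<open>
  The best passage time among exits from the horizontal axis. It does not involve the weights
  of the vertical axis.
\<close>
definition row_max :: "(int \<times> int \<Rightarrow> real) \<Rightarrow> nat \<Rightarrow> nat \<Rightarrow> real" where
  "row_max w m n = Max ((\<lambda>k. exit_term w (int m, int n) (int k)) ` {1..m})"

lemma row_max_le_passage: "1 \<le> m \<Longrightarrow> 1 \<le> n \<Longrightarrow> row_max w m n \<le> passage w m n"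
  unfolding row_max_def by (intro Max.boundedI) (auto intro: exit_term_le_passage)

lemma exits_row_max:
  assumes "1 \<le> n" "1 \<le> j" "exits w (int m, int n) (int j)"
  shows "passage w m n = row_max w m n"
proof -
  have j: "j \<le> m" using assms exits_def[of w "(int m, int n)" "int j"] by auto
  then have "passage w m n \<le> row_max w m n"
    using assms exits_iff[of m n w "int j"] unfolding row_max_def
    by (intro Max_ge) (auto intro!: image_eqI[of _ _ j])
  then show ?thesis using row_max_le_passage[of m n w] assms j by auto
qed

section \<open>The corner flip for exponential variables\<close>

abbreviation expd :: "real \<Rightarrow> real \<Rightarrow> ennreal" where
  "expd l x \<equiv> ennreal (exponential_density l x)"

lemma nn_integral_translate:
  fixes f :: "real \<Rightarrow> ennreal"
  assumes [measurable]: "f \<in> borel_measurable borel"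
  shows "(\<integral>\<^sup>+x. f x \<partial>lborel) = (\<integral>\<^sup>+x. f (x + t) \<partial>lborel)"
  using nn_integral_real_affine[of f 1 t] by (simp add: add.commute)

lemma nn_integral_expd: "0 < l \<Longrightarrow> (\<integral>\<^sup>+x. expd l x \<partial>lborel) = 1"
  using prob_space.emeasure_space_1[OF prob_space_exponential_density[of l]]
  by (simp add: emeasure_density)

text \<open>
  One half of the corner computation, on the event that \<open>x - y\<close> lies in \<open>D\<close>, hence is nonnegative.
  By the lack of memory, \<open>x - y\<close> and \<open>y\<close> become independent with rates \<open>a\<close> and \<open>a + b\<close>; integrating
  out \<open>y\<close> leaves \<open>b / (a + b)\<close>, and the translation by \<open>z\<close> turns the remaining densities of rates
  \<open>a\<close> and \<open>a + b\<close> into those of rates \<open>a\<close> and \<open>b\<close>. The set \<open>D\<close> is kept general because the two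
  halves must cover the diagonal only once.
\<close>
lemma corner_half:
  fixes f :: "real \<Rightarrow> real \<Rightarrow> ennreal"
  assumes ab: "0 < a" "0 < b"
    and f [measurable]: "case_prod f \<in> borel_measurable (borel \<Otimes>\<^sub>M borel)"
    and D [measurable]: "D \<in> sets borel" "D \<subseteq> {0..}"
  shows "(\<integral>\<^sup>+z. \<integral>\<^sup>+y. \<integral>\<^sup>+x. indicator D (x - y) * f (z + (x - y)) z * expd a x * expd b y * expd (a + b) z
            \<partial>lborel \<partial>lborel \<partial>lborel)
       = (\<integral>\<^sup>+z. \<integral>\<^sup>+u. indicator D (u - z) * f u z * expd a u * expd b z \<partial>lborel \<partial>lborel)"
proof -
  let ?c = "ennreal (b / (a + b))"
  have memoryless: "exponential_density a (d + y) * exponential_density b y =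
      b / (a + b) * exponential_density a d * exponential_density (a + b) y" if "0 \<le> d" "0 \<le> y" for d y
  proof -
    have "exp (- (d + y) * a) * exp (- y * b) = exp (- d * a) * exp (- y * (a + b))"
      by (simp add: exp_add[symmetric] algebra_simps)
    then have "(a * exp (- (d + y) * a)) * (b * exp (- y * b)) = a * b * (exp (- d * a) * exp (- y * (a + b)))"
      by (simp only: mult_ac)
    then show ?thesis using that ab by (simp add: exponential_density_def)
  qed
  have recombine: "exponential_density a (u - z) * (b / (a + b) * exponential_density (a + b) z) =
      exponential_density a u * exponential_density b z" if "0 \<le> u - z" "0 \<le> z" for u z
  proof -
    have "exp (- (u - z) * a) * exp (- z * (a + b)) = exp (- u * a) * exp (- z * b)"
      by (simp add: exp_add[symmetric] algebra_simps)
    then have "(a * exp (- (u - z) * a)) * (b * exp (- z * (a + b))) = a * b * (exp (- u * a) * exp (- z * b))"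
      by (simp only: mult_ac)
    then show ?thesis using that ab by (simp add: exponential_density_def)
  qed
  have e: "indicator D d * (expd a (d + y) * expd b y) = indicator D d * (?c * expd a d * expd (a + b) y)" for d y
  proof (cases "d \<in> D \<and> 0 \<le> y")
    case True
    then have "0 \<le> d" using D by auto
    then show ?thesis using True ab memoryless[of d y]
      by (simp add: ennreal_mult'[symmetric] exponential_density_nonneg)
  qed (auto simp: exponential_density_def indicator_def)
  have e2: "indicator D (u - z) * (expd a (u - z) * (?c * expd (a + b) z)) =
      indicator D (u - z) * (expd a u * expd b z)" for u z
  proof (cases "u - z \<in> D \<and> 0 \<le> z")
    case True
    then have "0 \<le> u - z" using D by auto
    then show ?thesis using True ab recombine[of u z]
      by (simp add: ennreal_mult'[symmetric] exponential_density_nonneg)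
  qed (auto simp: exponential_density_def indicator_def)
  have "(\<integral>\<^sup>+y. \<integral>\<^sup>+x. indicator D (x - y) * f (z + (x - y)) z * expd a x * expd b y * expd (a + b) z \<partial>lborel \<partial>lborel)
      = (\<integral>\<^sup>+u. indicator D (u - z) * f u z * expd a u * expd b z \<partial>lborel)" for z
  proof -
    have "(\<integral>\<^sup>+y. \<integral>\<^sup>+x. indicator D (x - y) * f (z + (x - y)) z * expd a x * expd b y * expd (a + b) z \<partial>lborel \<partial>lborel)
      = (\<integral>\<^sup>+y. \<integral>\<^sup>+d. indicator D d * (expd a (d + y) * expd b y) * (f (z + d) z * expd (a + b) z) \<partial>lborel \<partial>lborel)"
      proof (rule nn_integral_cong)
      fix y :: real
      show "(\<integral>\<^sup>+x. indicator D (x - y) * f (z + (x - y)) z * expd a x * expd b y * expd (a + b) z \<partial>lborel)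
        = (\<integral>\<^sup>+d. indicator D d * (expd a (d + y) * expd b y) * (f (z + d) z * expd (a + b) z) \<partial>lborel)"
        by (subst nn_integral_translate[of _ y]) (auto simp: mult_ac)
    qed
    also have "\<dots> = (\<integral>\<^sup>+y. (\<integral>\<^sup>+d. indicator D d * (?c * expd a d) * (f (z + d) z * expd (a + b) z) \<partial>lborel) * expd (a + b) y \<partial>lborel)"
      unfolding e by (subst nn_integral_multc[symmetric]) (auto simp: mult_ac)
    also have "\<dots> = (\<integral>\<^sup>+d. indicator D d * (?c * expd a d) * (f (z + d) z * expd (a + b) z) \<partial>lborel)"
      using ab by (subst nn_integral_cmult) (auto simp: nn_integral_expd)
    also have "\<dots> = (\<integral>\<^sup>+u. indicator D (u - z) * (expd a (u - z) * (?c * expd (a + b) z)) * f u z \<partial>lborel)"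
      by (subst nn_integral_translate[of _ "- z"]) (auto simp: mult_ac)
    also have "\<dots> = (\<integral>\<^sup>+u. indicator D (u - z) * f u z * expd a u * expd b z \<partial>lborel)"
      unfolding e2 by (auto simp: mult_ac)
    finally show ?thesis .
  qed
  then show ?thesis by simp
qed

text \<open>
  The two halves \<open>y \<le> x\<close> and \<open>x < y\<close> become the parts of the product law on either side
  of the diagonal.
\<close>
lemma corner_integral:
  fixes f :: "real \<Rightarrow> real \<Rightarrow> ennreal"
  assumes ab: "0 < a" "0 < b"
    and f [measurable]: "case_prod f \<in> borel_measurable (borel \<Otimes>\<^sub>M borel)"
  shows "(\<integral>\<^sup>+x. \<integral>\<^sup>+y. \<integral>\<^sup>+z. f (z + max (x - y) 0) (z + max (y - x) 0) * expd a x * expd b y * expd (a + b) z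
            \<partial>lborel \<partial>lborel \<partial>lborel)
       = (\<integral>\<^sup>+u. \<integral>\<^sup>+v. f u v * expd a u * expd b v \<partial>lborel \<partial>lborel)"
proof -
  define T1 T2 where
    "T1 x y z = indicator {0..} (x - y) * f (z + (x - y)) z * expd a x * expd b y * expd (a + b) z" and
    "T2 x y z = indicator {0<..} (y - x) * f z (z + (y - x)) * expd b y * expd a x * expd (b + a) z"
    for x y z :: real
  have [measurable (raw)]: "(\<lambda>p. T1 (g p) (h p) (k p)) \<in> borel_measurable M"
      "(\<lambda>p. T2 (g p) (h p) (k p)) \<in> borel_measurable M"
    if [measurable]: "g \<in> borel_measurable M" "h \<in> borel_measurable M" "k \<in> borel_measurable M"
    for g h k and M :: "'m measure"
    unfolding T1_def T2_def by measurable
  have split: "f (z + max (x - y) 0) (z + max (y - x) 0) * expd a x * expd b y * expd (a + b) z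
      = T1 x y z + T2 x y z" for x y z
    by (cases "y \<le> x") (auto simp: T1_def T2_def max_def mult_ac add.commute indicator_def)
  have "(\<integral>\<^sup>+x. \<integral>\<^sup>+y. \<integral>\<^sup>+z. T1 x y z \<partial>lborel \<partial>lborel \<partial>lborel) = (\<integral>\<^sup>+x. \<integral>\<^sup>+z. \<integral>\<^sup>+y. T1 x y z \<partial>lborel \<partial>lborel \<partial>lborel)"
    by (intro nn_integral_cong lborel_pair.Fubini') measurable
  also have "\<dots> = (\<integral>\<^sup>+z. \<integral>\<^sup>+x. \<integral>\<^sup>+y. T1 x y z \<partial>lborel \<partial>lborel \<partial>lborel)"
    by (intro lborel_pair.Fubini') measurable
  also have "\<dots> = (\<integral>\<^sup>+z. \<integral>\<^sup>+y. \<integral>\<^sup>+x. T1 x y z \<partial>lborel \<partial>lborel \<partial>lborel)"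
    by (intro nn_integral_cong lborel_pair.Fubini') measurable
  also have "\<dots> = (\<integral>\<^sup>+z. \<integral>\<^sup>+u. indicator {0..} (u - z) * f u z * expd a u * expd b z \<partial>lborel \<partial>lborel)"
    unfolding T1_def by (rule corner_half) (use ab in auto)
  also have "\<dots> = (\<integral>\<^sup>+u. \<integral>\<^sup>+z. indicator {0..} (u - z) * f u z * expd a u * expd b z \<partial>lborel \<partial>lborel)"
    by (intro lborel_pair.Fubini') measurable
  finally have T1: "(\<integral>\<^sup>+x. \<integral>\<^sup>+y. \<integral>\<^sup>+z. T1 x y z \<partial>lborel \<partial>lborel \<partial>lborel) = \<dots>" .
  have "(\<integral>\<^sup>+x. \<integral>\<^sup>+y. \<integral>\<^sup>+z. T2 x y z \<partial>lborel \<partial>lborel \<partial>lborel) = (\<integral>\<^sup>+x. \<integral>\<^sup>+z. \<integral>\<^sup>+y. T2 x y z \<partial>lborel \<partial>lborel \<partial>lborel)"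
    by (intro nn_integral_cong lborel_pair.Fubini') measurable
  also have "\<dots> = (\<integral>\<^sup>+z. \<integral>\<^sup>+x. \<integral>\<^sup>+y. T2 x y z \<partial>lborel \<partial>lborel \<partial>lborel)"
    by (intro lborel_pair.Fubini') measurable
  also have "\<dots> = (\<integral>\<^sup>+z. \<integral>\<^sup>+v. indicator {0<..} (v - z) * f z v * expd b v * expd a z \<partial>lborel \<partial>lborel)"
    unfolding T2_def by (rule corner_half[where f="\<lambda>u v. f v u"]) (use ab in auto)
  finally have T2: "(\<integral>\<^sup>+x. \<integral>\<^sup>+y. \<integral>\<^sup>+z. T2 x y z \<partial>lborel \<partial>lborel \<partial>lborel) = \<dots>" .
  have "(\<integral>\<^sup>+x. \<integral>\<^sup>+y. \<integral>\<^sup>+z. T1 x y z + T2 x y z \<partial>lborel \<partial>lborel \<partial>lborel) =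
    (\<integral>\<^sup>+x. \<integral>\<^sup>+y. \<integral>\<^sup>+z. T1 x y z \<partial>lborel \<partial>lborel \<partial>lborel) + (\<integral>\<^sup>+x. \<integral>\<^sup>+y. \<integral>\<^sup>+z. T2 x y z \<partial>lborel \<partial>lborel \<partial>lborel)"
    by (simp add: nn_integral_add)
  also have "\<dots> = (\<integral>\<^sup>+u. \<integral>\<^sup>+v. indicator {0..} (u - v) * f u v * expd a u * expd b v +
      indicator {0<..} (v - u) * f u v * expd b v * expd a u \<partial>lborel \<partial>lborel)"
    unfolding T1 T2 by (simp add: nn_integral_add)
  also have "\<dots> = (\<integral>\<^sup>+u. \<integral>\<^sup>+v. f u v * expd a u * expd b v \<partial>lborel \<partial>lborel)"
    by (intro nn_integral_cong) (auto simp: indicator_def mult_ac)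
  finally show ?thesis unfolding split .
qed

text \<open>
  The local form of Burke's theorem. Here \<open>X i\<close>, \<open>X j\<close>, \<open>X k\<close> are the horizontal increment below a
  lattice square, the vertical increment to its left, and the weight of its upper right corner; \<open>U\<close> and
  \<open>V\<close> are the increments above and to the right.
\<close>
lemma (in prob_space) corner_indep:
  assumes ab: "0 < a" "0 < b" and ind: "indep_vars (\<lambda>_. borel) X {i, j, k}"
    and dist: "i \<noteq> j" "i \<noteq> k" "j \<noteq> k"
    and X: "distributed M lborel (X i) (exponential_density a)"
    and Y: "distributed M lborel (X j) (exponential_density b)"
    and Z: "distributed M lborel (X k) (exponential_density (a + b))"
  defines "U \<equiv> \<lambda>x. X k x + max (X i x - X j x) 0"
    and "V \<equiv> \<lambda>x. X k x + max (X j x - X i x) 0"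
  shows "indep_var borel U borel V"
    and "distributed M lborel U (exponential_density a)"
    and "distributed M lborel V (exponential_density b)"
proof -
  have rv [measurable]: "random_variable borel (X i)" "random_variable borel (X j)" "random_variable borel (X k)"
    using X Y Z by (auto simp: distributed_def)
  have [measurable]: "random_variable borel U" "random_variable borel V"
    unfolding U_def V_def by measurable
  define r where "r s = (if s = i then a else if s = j then b else a + b)" for s
  have r: "0 < r s" for s using ab by (simp add: r_def)
  interpret prod: product_sigma_finite "\<lambda>s. density lborel (exponential_density (r s))"
    by (intro product_sigma_finite.intro prob_space_imp_sigma_finite prob_space_exponential_density r)
  have dens: "distr M borel (X s) = density lborel (exponential_density (r s))" if "s \<in> {i,j,k}" for s
    using X Y Z that dist by (auto simp: r_def distributed_distr_eq_density[symmetric] cong: distr_cong)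
  have joint: "distr M (PiM {i,j,k} (\<lambda>_. borel)) (\<lambda>x. \<lambda>s\<in>{i,j,k}. X s x) =
      PiM {i,j,k} (\<lambda>s. density lborel (exponential_density (r s)))"
  proof -
    have "distr M (PiM {i,j,k} (\<lambda>_. borel)) (\<lambda>x. \<lambda>s\<in>{i,j,k}. X s x) =
        PiM {i,j,k} (\<lambda>s. distr M borel (X s))"
      using ind rv by (subst (asm) indep_vars_iff_distr_eq_PiM') auto
    also have "\<dots> = PiM {i,j,k} (\<lambda>s. density lborel (exponential_density (r s)))"
      by (rule PiM_cong) (auto simp: dens)
    finally show ?thesis .
  qed
  interpret da: prob_space "density lborel (exponential_density a)"
    using ab by (intro prob_space_exponential_density) auto
  interpret db: prob_space "density lborel (exponential_density b)"
    using ab by (intro prob_space_exponential_density) auto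
  have law: "emeasure M (U -` A \<inter> V -` B \<inter> space M) =
      emeasure (density lborel (exponential_density a)) A * emeasure (density lborel (exponential_density b)) B"
    if [measurable]: "A \<in> sets borel" "B \<in> sets borel" for A B
  proof -
    define f :: "real \<Rightarrow> real \<Rightarrow> ennreal" where "f u v = indicator A u * indicator B v" for u v
    have [measurable]: "case_prod f \<in> borel_measurable (borel \<Otimes>\<^sub>M borel)"
      unfolding f_def by measurable
    have "emeasure M (U -` A \<inter> V -` B \<inter> space M) = (\<integral>\<^sup>+x. indicator (U -` A \<inter> V -` B \<inter> space M) x \<partial>M)"
      by (rule nn_integral_indicator[symmetric]) measurable
    also have "\<dots> = (\<integral>\<^sup>+x. f (U x) (V x) \<partial>M)"
      by (intro nn_integral_cong) (auto simp: f_def indicator_def)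
    also have "\<dots> = (\<integral>\<^sup>+\<omega>. f (\<omega> k + max (\<omega> i - \<omega> j) 0) (\<omega> k + max (\<omega> j - \<omega> i) 0)
        \<partial>distr M (PiM {i,j,k} (\<lambda>_. borel)) (\<lambda>x. \<lambda>s\<in>{i,j,k}. X s x))"
      by (subst nn_integral_distr) (auto simp: U_def V_def intro!: measurable_restrict)
    also have "\<dots> = (\<integral>\<^sup>+x. \<integral>\<^sup>+y. \<integral>\<^sup>+z. f (z + max (x - y) 0) (z + max (y - x) 0)
         \<partial>density lborel (exponential_density (r k))
         \<partial>density lborel (exponential_density (r j)) \<partial>density lborel (exponential_density (r i)))"
    proof -
      note [measurable_cong] = sets_density
      have last: "(\<integral>\<^sup>+\<omega>. f (\<omega> k + max (x - y) 0) (\<omega> k + max (y - x) 0)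
          \<partial>PiM {k} (\<lambda>s. density lborel (exponential_density (r s)))) =
        (\<integral>\<^sup>+z. f (z + max (x - y) 0) (z + max (y - x) 0) \<partial>density lborel (exponential_density (r k)))" for x y
        by (rule prod.product_nn_integral_singleton) measurable
      show ?thesis
        unfolding joint
        apply (subst prod.product_nn_integral_insert_rev)
           apply (use dist in auto)[3]
        apply (subst prod.product_nn_integral_insert_rev)
           apply (use dist in auto)[3]
        apply (use dist in \<open>simp add: last\<close>)
        done
    qed
    also have "\<dots> = (\<integral>\<^sup>+x. \<integral>\<^sup>+y. \<integral>\<^sup>+z. f (z + max (x - y) 0) (z + max (y - x) 0) * expd a x * expd b y * expd (a + b) z
            \<partial>lborel \<partial>lborel \<partial>lborel)"
      using dist by (simp add: nn_integral_density nn_integral_cmult[symmetric] mult_ac r_def)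
    also have "\<dots> = (\<integral>\<^sup>+u. \<integral>\<^sup>+v. f u v * expd a u * expd b v \<partial>lborel \<partial>lborel)"
      by (rule corner_integral) (use ab in auto)
    also have "\<dots> = (\<integral>\<^sup>+u. expd a u * indicator A u * (\<integral>\<^sup>+v. expd b v * indicator B v \<partial>lborel) \<partial>lborel)"
      by (subst nn_integral_cmult[symmetric]) (auto simp: f_def mult_ac)
    also have "\<dots> = (\<integral>\<^sup>+u. expd a u * indicator A u \<partial>lborel) * (\<integral>\<^sup>+v. expd b v * indicator B v \<partial>lborel)"
      by (subst nn_integral_multc) auto
    finally show ?thesis by (simp add: emeasure_density)
  qed
  have "distr M lborel U = density lborel (exponential_density a)"
  proof (rule measure_eqI)
    fix A assume "A \<in> sets (distr M lborel U)"
    then show "emeasure (distr M lborel U) A = emeasure (density lborel (exponential_density a)) A"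
      using law[of A UNIV] db.emeasure_space_1 by (simp add: emeasure_distr)
  qed simp
  then show DU: "distributed M lborel U (exponential_density a)"
    by (simp add: distributed_def)
  have "distr M lborel V = density lborel (exponential_density b)"
  proof (rule measure_eqI)
    fix A assume "A \<in> sets (distr M lborel V)"
    then show "emeasure (distr M lborel V) A = emeasure (density lborel (exponential_density b)) A"
      using law[of UNIV A] da.emeasure_space_1 by (simp add: emeasure_distr)
  qed simp
  then show DV: "distributed M lborel V (exponential_density b)"
    by (simp add: distributed_def)
  have d: "distr M borel U = density lborel (exponential_density a)"
    "distr M borel V = density lborel (exponential_density b)"
    using DU DV by (simp_all add: distributed_distr_eq_density[symmetric] cong: distr_cong)
  have "density lborel (exponential_density a) \<Otimes>\<^sub>M density lborel (exponential_density b) =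
      distr M (borel \<Otimes>\<^sub>M borel) (\<lambda>x. (U x, V x))"
  proof (rule pair_measure_eqI)
    fix A B assume AB: "A \<in> sets (density lborel (exponential_density a))" "B \<in> sets (density lborel (exponential_density b))"
    have "(\<lambda>x. (U x, V x)) -` (A \<times> B) \<inter> space M = U -` A \<inter> V -` B \<inter> space M" by auto
    then show "emeasure (density lborel (exponential_density a)) A * emeasure (density lborel (exponential_density b)) B =
       emeasure (distr M (borel \<Otimes>\<^sub>M borel) (\<lambda>x. (U x, V x))) (A \<times> B)"
      using AB by (simp add: emeasure_distr law)
  qed (auto intro: da.sigma_finite_measure_axioms db.sigma_finite_measure_axioms cong: sets_pair_measure_cong)
  then show "indep_var borel U borel V"
    unfolding indep_var_distribution_eq d by simp
qed

section \<open>Burke's theorem\<close>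

definition sites :: "(int \<times> int) set" where
  "sites = bulk \<union> axis1 \<union> axis2"

text \<open>
  Meaningful on \<open>sites\<close>, where it merges the three cases of \<open>stationary_weights\<close>.
\<close>
definition rate :: "real \<Rightarrow> int \<times> int \<Rightarrow> real" where
  "rate \<rho> z = (if snd z = 0 then 1 - \<rho> else if fst z = 0 then \<rho> else 1)"

lemma sites_iff: "(a, b) \<in> sites \<longleftrightarrow> 0 \<le> a \<and> 0 \<le> b \<and> (a, b) \<noteq> (0, 0)"
  by (auto simp: sites_def bulk_def axis1_def axis2_def)

lemma stationary_weights_iff:
  "stationary_weights P \<rho> W \<longleftrightarrow> prob_space P \<and> prob_space.indep_vars P (\<lambda>_. borel) W sites \<and>
     (\<forall>z\<in>sites. distributed P lborel (W z) (exponential_density (rate \<rho> z)))"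
proof -
  have "rate \<rho> z = 1" if "z \<in> bulk" for z using that by (auto simp: rate_def bulk_def)
  moreover have "rate \<rho> z = 1 - \<rho>" if "z \<in> axis1" for z using that by (auto simp: rate_def axis1_def)
  moreover have "rate \<rho> z = \<rho>" if "z \<in> axis2" for z using that by (auto simp: rate_def axis2_def)
  ultimately show ?thesis unfolding stationary_weights_def sites_def
    by (auto simp: Ball_def)
qed

lemma (in prob_space) indep_vars_reindex:
  assumes X: "indep_vars M' X (h ` I)" and h: "inj_on h I"
  shows "indep_vars (\<lambda>i. M' (h i)) (\<lambda>i. X (h i)) I"
  unfolding indep_vars_def2
proof (intro conjI ballI indep_setsI)
  show "random_variable (M' (h i)) (X (h i))" if "i \<in> I" for i
    using X that unfolding indep_vars_def2 by auto
  then show "{X (h i) -` A \<inter> space M |A. A \<in> sets (M' (h i))} \<subseteq> events" if "i \<in> I" for i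
    using that by (auto intro: measurable_sets)
  fix A J assume J: "J \<noteq> {}" "J \<subseteq> I" "finite J"
    and A: "\<forall>j\<in>J. A j \<in> {X (h j) -` A \<inter> space M |A. A \<in> sets (M' (h j))}"
  have hJ: "inj_on h J" using h J by (rule_tac inj_on_subset)
  define B where "B = A \<circ> the_inv_into J h"
  have B: "B (h j) = A j" if "j \<in> J" for j
    using that hJ by (simp add: B_def the_inv_into_f_f)
  have "prob (\<Inter>j\<in>h ` J. B j) = (\<Prod>j\<in>h ` J. prob (B j))"
    using X J A B unfolding indep_vars_def2 by (intro indep_setsD[where I="h ` I"]) auto
  then show "prob (\<Inter>j\<in>J. A j) = (\<Prod>j\<in>J. prob (A j))"
    by (simp add: prod.reindex[OF hJ] B)
qed

lemma (in prob_space) indep_vars_finite_subsets: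
  assumes "\<And>J. J \<subseteq> I \<Longrightarrow> finite J \<Longrightarrow> indep_vars M' X J"
  shows "indep_vars M' X I"
  unfolding indep_vars_def2
proof
  show "\<forall>i\<in>I. random_variable (M' i) (X i)"
    using assms[of "{_}"] unfolding indep_vars_def2 by auto
  show "indep_sets (\<lambda>i. {X i -` A \<inter> space M |A. A \<in> sets (M' i)}) I"
    by (subst indep_sets_finite_index_sets) (use assms in \<open>auto simp: indep_vars_def2\<close>)
qed

text \<open>
  The triple \<open>(i, j, k)\<close> is independent of the rest of the family, so an independent pair
  computed from it may take its place.
\<close>
lemma (in prob_space) indep_vars_replace_pair:
  fixes X :: "'i \<Rightarrow> 'a \<Rightarrow> real"
  assumes X: "indep_vars (\<lambda>_. borel) X I" and ijk: "i \<in> I" "j \<in> I" "k \<in> I" "i \<noteq> j"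
    and UV: "indep_var borel (\<lambda>x. f (X i x, X j x, X k x)) borel (\<lambda>x. g (X i x, X j x, X k x))"
    and f [measurable]: "f \<in> borel_measurable (borel \<Otimes>\<^sub>M (borel \<Otimes>\<^sub>M borel))"
    and g [measurable]: "g \<in> borel_measurable (borel \<Otimes>\<^sub>M (borel \<Otimes>\<^sub>M borel))"
  shows "indep_vars (\<lambda>_. borel)
    (X(i := \<lambda>x. f (X i x, X j x, X k x), j := \<lambda>x. g (X i x, X j x, X k x))) (I - {k})"
proof -
  let ?U = "\<lambda>x. f (X i x, X j x, X k x)" and ?V = "\<lambda>x. g (X i x, X j x, X k x)"
  define Y where "Y = X(i := ?U, j := ?V)"
  have rvX [measurable]: "random_variable borel (X s)" if "s \<in> I" for s
    using X that by (simp add: indep_vars_def2)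
  note [measurable] = ijk
  have Y_rv: "random_variable borel (Y s)" if "s \<in> I" for s
    using that unfolding Y_def by (cases "s = j"; cases "s = i") auto
  have "indep_vars (\<lambda>_. borel) Y (I - {k})"
    unfolding indep_vars_def2
  proof (intro conjI ballI indep_setsI)
    show "random_variable borel (Y s)" if "s \<in> I - {k}" for s
      using that Y_rv by auto
    then show "{Y s -` A \<inter> space M |A. A \<in> sets borel} \<subseteq> events" if "s \<in> I - {k}" for s
      using that by (auto intro: measurable_sets)
  next
    fix A J assume J: "J \<noteq> {}" "J \<subseteq> I - {k}" "finite J"
      and A: "\<forall>s\<in>J. A s \<in> {Y s -` A \<inter> space M |A. A \<in> sets borel}"
    from A have "\<forall>s\<in>J. \<exists>B. B \<in> sets borel \<and> A s = Y s -` B \<inter> space M" by blast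
    then obtain B0 where B0: "\<And>s. s \<in> J \<Longrightarrow> B0 s \<in> sets borel \<and> A s = Y s -` B0 s \<inter> space M"
      by metis
    \<comment> \<open>Enlarging \<open>J\<close> by \<open>i\<close> and \<open>j\<close> with the whole space costs nothing and avoids a case distinction.\<close>
    define B where "B s = (if s \<in> J then B0 s else UNIV)" for s
    have B [measurable]: "B s \<in> sets borel" for s using B0 by (auto simp: B_def)
    define E where "E s = Y s -` B s \<inter> space M" for s
    have EA: "E s = A s" if "s \<in> J" for s using B0[OF that] that by (simp add: E_def B_def)
    have E1: "E s = space M" if "s \<notin> J" for s using that by (simp add: E_def B_def)
    define R where "R = J - {i, j}"
    have R: "finite R" "R \<subseteq> I" "R \<inter> {i,j,k} = {}" using J by (auto simp: R_def)
    have Ev: "E s \<in> events" if "s \<in> I" for s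
      unfolding E_def using Y_rv[OF that] by measurable
    have "indep_var (PiM {i,j,k} (\<lambda>_. borel)) (\<lambda>\<omega>. restrict (\<lambda>s. X s \<omega>) {i,j,k})
        (PiM R (\<lambda>_. borel)) (\<lambda>\<omega>. restrict (\<lambda>s. X s \<omega>) R)"
      by (rule indep_var_restrict[OF X]) (use R ijk in auto)
    moreover define P where "P = {\<omega> \<in> space (PiM {i,j,k} (\<lambda>_. borel :: real measure)).
        f (\<omega> i, \<omega> j, \<omega> k) \<in> B i \<and> g (\<omega> i, \<omega> j, \<omega> k) \<in> B j}"
    moreover have "P \<in> sets (PiM {i,j,k} (\<lambda>_. borel))"
      unfolding P_def by measurable
    moreover have "PiE R B \<in> sets (PiM R (\<lambda>_. borel))"
      using R by (intro sets_PiM_I_finite) auto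
    ultimately have "prob ((\<lambda>x. (restrict (\<lambda>s. X s x) {i,j,k}, restrict (\<lambda>s. X s x) R)) -` (P \<times> PiE R B) \<inter> space M) =
       prob ((\<lambda>\<omega>. restrict (\<lambda>s. X s \<omega>) {i,j,k}) -` P \<inter> space M) * prob ((\<lambda>\<omega>. restrict (\<lambda>s. X s \<omega>) R) -` PiE R B \<inter> space M)"
      by (intro indep_varD)
    moreover have P: "(\<lambda>\<omega>. restrict (\<lambda>s. X s \<omega>) {i,j,k}) -` P \<inter> space M = E i \<inter> E j"
      using ijk by (auto simp: P_def E_def Y_def space_PiM)
    moreover have PR: "(\<lambda>\<omega>. restrict (\<lambda>s. X s \<omega>) R) -` PiE R B \<inter> space M = space M \<inter> (\<Inter>s\<in>R. E s)"
    proof -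
      have "Y s = X s" if "s \<in> R" for s using that R by (auto simp: Y_def)
      then show ?thesis by (auto simp: E_def PiE_iff)
    qed
    moreover have "(\<lambda>x. (restrict (\<lambda>s. X s x) {i,j,k}, restrict (\<lambda>s. X s x) R)) -` (P \<times> PiE R B) \<inter> space M =
       E i \<inter> E j \<inter> (space M \<inter> (\<Inter>s\<in>R. E s))"
      using P PR by blast
    ultimately have 1: "prob (E i \<inter> E j \<inter> (space M \<inter> (\<Inter>s\<in>R. E s))) = prob (E i \<inter> E j) * prob (space M \<inter> (\<Inter>s\<in>R. E s))"
      by simp
    have Eij: "E i = ?U -` B i \<inter> space M" "E j = ?V -` B j \<inter> space M"
      using \<open>i \<noteq> j\<close> by (auto simp: E_def Y_def)
    have "(\<lambda>x. (?U x, ?V x)) -` (B i \<times> B j) \<inter> space M = E i \<inter> E j" unfolding Eij by auto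
    then have 2: "prob (E i \<inter> E j) = prob (E i) * prob (E j)"
      using indep_varD[OF UV B[of i] B[of j]] unfolding Eij by simp
    have 3: "prob (space M \<inter> (\<Inter>s\<in>R. E s)) = (\<Prod>s\<in>R. prob (E s))"
    proof (cases "R = {}")
      case False
      have e: "E s = X s -` B s \<inter> space M" if "s \<in> R" for s using that R by (auto simp: E_def Y_def)
      have "prob (\<Inter>s\<in>R. X s -` B s \<inter> space M) = (\<Prod>s\<in>R. prob (X s -` B s \<inter> space M))"
        by (rule indep_varsD_finite[OF indep_vars_subset[OF X \<open>R \<subseteq> I\<close>]]) (use False R in auto)
      moreover have "space M \<inter> (\<Inter>s\<in>R. E s) = (\<Inter>s\<in>R. X s -` B s \<inter> space M)"
        using False e by auto
      ultimately show ?thesis using e by simp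
    qed (simp add: prob_space)
    have "(\<Inter>s\<in>J. A s) = E i \<inter> E j \<inter> (space M \<inter> (\<Inter>s\<in>R. E s))"
    proof -
      have "(\<Inter>s\<in>J. A s) = (\<Inter>s\<in>J. E s)" using EA by simp
      also have "\<dots> = E i \<inter> E j \<inter> (space M \<inter> (\<Inter>s\<in>R. E s))"
      proof -
        have "E s \<subseteq> space M" for s by (auto simp: E_def)
        then show ?thesis using J E1[of i] E1[of j]
          by (cases "i \<in> J"; cases "j \<in> J") (auto simp: R_def, blast+)
      qed
      finally show ?thesis .
    qed
    then have "prob (\<Inter>s\<in>J. A s) = prob (E i) * prob (E j) * (\<Prod>s\<in>R. prob (E s))"
      using 1 2 3 by simp
    also have "\<dots> = (\<Prod>s\<in>insert i (insert j R). prob (E s))"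
      using \<open>i \<noteq> j\<close> R by simp
    also have "\<dots> = (\<Prod>s\<in>J. prob (E s))"
      by (rule prod.mono_neutral_right) (use J R E1 in \<open>auto simp: R_def prob_space\<close>)
    finally show "prob (\<Inter>s\<in>J. A s) = (\<Prod>s\<in>J. prob (A s))" using EA by simp
  qed
  then show ?thesis by (simp add: Y_def)
qed

text \<open>
  The family halfway through moving the base point from \<open>0\<close> to \<open>e1\<close>: the first \<open>n\<close> vertical
  boundary weights have been replaced by the increments along the line through \<open>e1\<close>, the site
  \<open>(1, 0)\<close> carries the horizontal increment at height \<open>n\<close>, and the bulk weights used up so far are dropped.
\<close>
definition hybrid :: "nat \<Rightarrow> (int \<times> int \<Rightarrow> real) \<Rightarrow> int \<times> int \<Rightarrow> real" where
  "hybrid n w z =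
     (if fst z = 0 \<and> 1 \<le> snd z \<and> snd z \<le> int n
        then passage w 1 (nat (snd z)) - passage w 1 (nat (snd z - 1))
      else if z = (1, 0) then passage w 1 n - passage w 0 n
      else w z)"

definition hybrid_sites :: "nat \<Rightarrow> (int \<times> int) set" where
  "hybrid_sites n = sites - {(1, b) |b. 1 \<le> b \<and> b \<le> int n}"

text \<open>
  Going from \<open>n\<close> to \<open>n + 1\<close> is one corner flip: it consumes the bulk weight at \<open>(1, n + 1)\<close> and
  replaces the increments at \<open>(1, 0)\<close> and \<open>(0, n + 1)\<close>.
\<close>
lemma hybrid_stationary:
  assumes W: "stationary_weights P \<rho> W" and \<rho>: "0 < \<rho>" "\<rho> < 1"
  shows "prob_space.indep_vars P (\<lambda>_. borel) (\<lambda>z x. hybrid n (\<lambda>s. W s x) z) (hybrid_sites n) \<and>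
    (\<forall>z\<in>hybrid_sites n. distributed P lborel (\<lambda>x. hybrid n (\<lambda>s. W s x) z) (exponential_density (rate \<rho> z)))"
proof (induction n)
  interpret prob_space P using W by (simp add: stationary_weights_iff)
  { case 0
    have "(\<lambda>x. hybrid 0 (\<lambda>s. W s x) z) = W z" "hybrid_sites 0 = sites" for z
      by (auto simp: hybrid_def hybrid_sites_def fun_eq_iff)
    then show ?case using W by (simp add: stationary_weights_iff)
  next
    case (Suc n)
    define X where "X = (\<lambda>z x. hybrid n (\<lambda>s. W s x) z)"
    let ?i = "(1, 0) :: int \<times> int" and ?j = "(0, int (Suc n))" and ?k = "(1, int (Suc n))"
    have mem: "?i \<in> hybrid_sites n" "?j \<in> hybrid_sites n" "?k \<in> hybrid_sites n"
      by (auto simp: hybrid_sites_def sites_iff)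
    have ind: "indep_vars (\<lambda>_. borel) X (hybrid_sites n)"
      and dist: "\<And>z. z \<in> hybrid_sites n \<Longrightarrow> distributed P lborel (X z) (exponential_density (rate \<rho> z))"
      using Suc by (auto simp: X_def)
    define f g :: "real \<times> real \<times> real \<Rightarrow> real" where
      "f = (\<lambda>(x, y, z). z + max (x - y) 0)" and "g = (\<lambda>(x, y, z). z + max (y - x) 0)"
    have [measurable]: "f \<in> borel_measurable (borel \<Otimes>\<^sub>M (borel \<Otimes>\<^sub>M borel))"
      "g \<in> borel_measurable (borel \<Otimes>\<^sub>M (borel \<Otimes>\<^sub>M borel))" unfolding f_def g_def by measurable
    have ind3: "indep_vars (\<lambda>_. borel) X {?i, ?j, ?k}"
      by (rule indep_vars_subset[OF ind]) (use mem in auto)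
    have d: "distributed P lborel (X ?i) (exponential_density (1 - \<rho>))"
      "distributed P lborel (X ?j) (exponential_density \<rho>)"
      "distributed P lborel (X ?k) (exponential_density (1 - \<rho> + \<rho>))"
      using dist[OF mem(1)] dist[OF mem(2)] dist[OF mem(3)] by (simp_all add: rate_def)
    have \<rho>': "0 < 1 - \<rho>" using \<rho> by simp
    note corner = corner_indep[OF \<rho>' \<rho>(1) ind3 _ _ _ d]
    have fg: "(\<lambda>x. f (X ?i x, X ?j x, X ?k x)) = (\<lambda>x. X ?k x + max (X ?i x - X ?j x) 0)"
      "(\<lambda>x. g (X ?i x, X ?j x, X ?k x)) = (\<lambda>x. X ?k x + max (X ?j x - X ?i x) 0)"
      by (auto simp: f_def g_def)
    have fg_indep: "indep_var borel (\<lambda>x. f (X ?i x, X ?j x, X ?k x)) borel (\<lambda>x. g (X ?i x, X ?j x, X ?k x))"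
      unfolding fg by (rule corner(1)) auto
    have fg_dist: "distributed P lborel (\<lambda>x. f (X ?i x, X ?j x, X ?k x)) (exponential_density (1 - \<rho>))"
      "distributed P lborel (\<lambda>x. g (X ?i x, X ?j x, X ?k x)) (exponential_density \<rho>)"
      unfolding fg by (rule corner; simp)+
    define Y where "Y = X(?i := \<lambda>x. f (X ?i x, X ?j x, X ?k x), ?j := \<lambda>x. g (X ?i x, X ?j x, X ?k x))"
    have "indep_vars (\<lambda>_. borel) Y (hybrid_sites n - {?k})"
      unfolding Y_def
      by (rule indep_vars_replace_pair[OF ind mem _ fg_indep]) auto
    moreover have S: "hybrid_sites n - {?k} = hybrid_sites (Suc n)"
      by (auto simp: hybrid_sites_def)
    moreover have Y: "Y z = (\<lambda>x. hybrid (Suc n) (\<lambda>s. W s x) z)" if "z \<in> hybrid_sites (Suc n)" for z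
    proof -
      consider "z = ?i" | "z = ?j" | "z \<noteq> ?i" "z \<noteq> ?j" by blast
      then show ?thesis
      proof cases
        case 1
        then show ?thesis by (auto simp: fun_eq_iff Y_def X_def f_def hybrid_def max_def)
      next
        case 2
        then show ?thesis by (auto simp: fun_eq_iff Y_def X_def g_def hybrid_def max_def nat_add_distrib)
      next
        case 3
        then have "hybrid n w z = hybrid (Suc n) w z" for w
          by (cases z) (auto simp: hybrid_def)
        then show ?thesis using 3 by (simp add: Y_def X_def)
      qed
    qed
    moreover have "distributed P lborel (Y z) (exponential_density (rate \<rho> z))"
      if "z \<in> hybrid_sites n" for z
    proof -
      consider "z = ?i" | "z = ?j" | "z \<noteq> ?i" "z \<noteq> ?j" by blast
      then show ?thesis
        by cases (use fg_dist dist[OF that] in \<open>auto simp: Y_def rate_def\<close>)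
    qed
    moreover have "hybrid_sites (Suc n) \<subseteq> hybrid_sites n" by (auto simp: hybrid_sites_def)
    moreover have "indep_vars (\<lambda>_. borel) Y (hybrid_sites (Suc n)) \<longleftrightarrow>
        indep_vars (\<lambda>_. borel) (\<lambda>z x. hybrid (Suc n) (\<lambda>s. W s x) z) (hybrid_sites (Suc n))"
      by (rule indep_vars_cong) (simp_all only: Y)
    ultimately show ?case
      using Y by (metis subsetD) }
qed

text \<open>
  Burke's theorem for the stationary model. Any finite set of sites of the shifted model embeds
  into the hybrid family of a sufficiently large height; sites off the vertical axis move one step to
  the right, past the column that was consumed.
\<close>
lemma stationary_shift:
  assumes W: "stationary_weights P \<rho> W" and \<rho>: "0 < \<rho>" "\<rho> < 1"
  shows "stationary_weights P \<rho> (\<lambda>z x. shift (\<lambda>s. W s x) z)"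
proof -
  interpret prob_space P using W by (simp add: stationary_weights_iff)
  define h :: "int \<times> int \<Rightarrow> int \<times> int" where "h z = (if fst z = 0 then z else z + e1)" for z
  have h_inj: "inj_on h sites"
    by (auto simp: inj_on_def h_def e1_def sites_iff split: if_splits)
  have h_mem: "h z \<in> hybrid_sites n" if "z \<in> sites" for z n
    using that by (cases z) (auto simp: h_def e1_def hybrid_sites_def sites_iff)
  have rate_h: "rate \<rho> (h z) = rate \<rho> z" if "z \<in> sites" for z
    using that by (cases z) (auto simp: h_def e1_def rate_def sites_iff)
  have eq: "shift w z = hybrid n w (h z)" if "z \<in> sites" "snd z \<le> int n" for w n z
    using that by (cases z) (auto simp: h_def e1_def hybrid_def shift_def sites_iff)
  have "indep_vars (\<lambda>_. borel) (\<lambda>z x. shift (\<lambda>s. W s x) z) J" if J: "J \<subseteq> sites" "finite J" for J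
  proof -
    obtain n where n: "\<And>z. z \<in> J \<Longrightarrow> snd z \<le> int n"
    proof -
      have "snd z \<le> int (nat (Max (snd ` J)))" if "z \<in> J" for z
      proof -
        have "snd z \<le> Max (snd ` J)" using that J by (intro Max_ge) auto
        then show ?thesis by arith
      qed
      then show thesis using that by blast
    qed
    have "indep_vars (\<lambda>_. borel) (\<lambda>z x. hybrid n (\<lambda>s. W s x) z) (h ` J)"
      using hybrid_stationary[OF W \<rho>] h_mem J by (blast intro: indep_vars_subset)
    then have "indep_vars (\<lambda>_. borel) (\<lambda>z x. hybrid n (\<lambda>s. W s x) (h z)) J"
      by (rule indep_vars_reindex) (rule inj_on_subset[OF h_inj J(1)])
    also have "?this \<longleftrightarrow> ?thesis"
    proof (rule indep_vars_cong)
      show "(\<lambda>x. hybrid n (\<lambda>s. W s x) (h z)) = (\<lambda>x. shift (\<lambda>s. W s x) z)" if "z \<in> J" for z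
        using that J n by (intro ext eq[symmetric]) auto
    qed auto
    finally show ?thesis .
  qed
  then have "indep_vars (\<lambda>_. borel) (\<lambda>z x. shift (\<lambda>s. W s x) z) sites"
    by (rule indep_vars_finite_subsets)
  moreover have "distributed P lborel (\<lambda>x. shift (\<lambda>s. W s x) z) (exponential_density (rate \<rho> z))"
    if "z \<in> sites" for z
  proof -
    have "distributed P lborel (\<lambda>x. hybrid (nat (snd z)) (\<lambda>s. W s x) (h z)) (exponential_density (rate \<rho> (h z)))"
      using hybrid_stationary[OF W \<rho>] h_mem[OF that] by blast
    then show ?thesis using that eq[of z "nat (snd z)"] rate_h[OF that] by simp
  qed
  ultimately show ?thesis by (simp add: stationary_weights_iff prob_space_axioms)
qed

lemma stationary_shift_iter:
  assumes W: "stationary_weights P \<rho> W" and \<rho>: "0 < \<rho>" "\<rho> < 1"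
  shows "stationary_weights P \<rho> (\<lambda>z x. (shift ^^ k) (\<lambda>s. W s x) z)"
proof (induction k)
  case (Suc k)
  from stationary_shift[OF Suc \<rho>] show ?case by simp
qed (use W in simp)

lemma stationary_flip:
  assumes W: "stationary_weights P \<rho> W"
  shows "stationary_weights P (1 - \<rho>) (flip W)"
proof -
  interpret prob_space P using W by (simp add: stationary_weights_iff)
  have s: "prod.swap ` sites = sites"
  proof -
    have "prod.swap z \<in> sites" if "z \<in> sites" for z using that by (cases z) (auto simp: sites_iff)
    then show ?thesis by (metis (no_types, lifting) image_iff subsetI subset_antisym image_subsetI swap_swap)
  qed
  have "indep_vars (\<lambda>_. borel) (\<lambda>z. W (prod.swap z)) sites"
    by (rule indep_vars_reindex) (use W in \<open>auto simp: s stationary_weights_iff\<close>)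
  moreover have "distributed P lborel (W (prod.swap z)) (exponential_density (rate (1 - \<rho>) z))"
    if "z \<in> sites" for z
  proof -
    have "prod.swap z \<in> sites" "rate (1 - \<rho>) z = rate \<rho> (prod.swap z)"
      using that by (cases z, auto simp: sites_iff rate_def)+
    then show ?thesis using W by (simp add: stationary_weights_iff)
  qed
  ultimately show ?thesis
    by (simp add: stationary_weights_iff prob_space_axioms flip_def[abs_def])
qed

section \<open>Measurability and law of the event\<close>

lemma paths_bulk: "p \<in> paths x y \<Longrightarrow> x \<in> bulk \<Longrightarrow> set p \<subseteq> bulk"
  using paths_bounds(1)[of p x y] by (fastforce simp: bulk_def less_eq_prod_def subset_iff)

lemma lpp_cong:
  assumes "x \<in> bulk" "\<And>s. s \<in> bulk \<Longrightarrow> w s = w' s"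
  shows "lpp w x y = lpp w' x y"
proof -
  have "(\<Sum>z\<leftarrow>p. w z) = (\<Sum>z\<leftarrow>p. w' z)" if "p \<in> paths x y" for p
    using paths_bulk[OF that assms(1)] assms(2)
    by (intro arg_cong[of _ _ sum_list] map_cong) auto
  then show ?thesis by (simp add: lpp_def cong: image_cong)
qed

lemma exit_term_cong:
  assumes "k \<noteq> 0" "\<And>s. s \<in> sites \<Longrightarrow> w s = w' s"
  shows "exit_term w y k = exit_term w' y k"
proof -
  have "lpp w (k, 1) y = lpp w' (k, 1) y" if "k > 0"
    using assms that by (intro lpp_cong) (auto simp: bulk_def sites_def)
  moreover have "lpp w (1, - k) y = lpp w' (1, - k) y" if "k < 0"
    using assms that by (intro lpp_cong) (auto simp: bulk_def sites_def)
  ultimately show ?thesis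
    using assms by (auto simp: exit_term_def sites_iff intro!: sum.cong)
qed

lemma passage_cong:
  assumes "\<And>s. s \<in> sites \<Longrightarrow> w s = w' s"
  shows "passage w i j = passage w' i j"
  using assms by (induction w i j rule: passage.induct) (auto simp: sites_iff)

lemma bulkE:
  assumes "z \<in> bulk" obtains m n where "z = (int m, int n)" "1 \<le> m" "1 \<le> n"
  using assms that[of "nat (fst z)" "nat (snd z)"] by (cases z) (auto simp: bulk_def)

lemma exits_cong:
  assumes "z \<in> bulk" "\<And>s. s \<in> sites \<Longrightarrow> w s = w' s"
  shows "exits w z k = exits w' z k"
  using assms(1) exit_term_cong[of k w w' z] passage_cong[of w w'] assms(2)
  by (elim bulkE) (auto simp: exits_iff)

lemma borel_measurable_lpp:
  assumes "x \<in> bulk" and X: "\<And>s. s \<in> bulk \<Longrightarrow> X s \<in> borel_measurable M"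
  shows "(\<lambda>\<omega>. lpp (\<lambda>s. X s \<omega>) x y) \<in> borel_measurable M"
  unfolding lpp_def
proof (rule borel_measurable_Max[OF finite_paths])
  fix p assume "p \<in> paths x y"
  then have "set p \<subseteq> bulk"
    using paths_bulk assms by blast
  then show "(\<lambda>\<omega>. \<Sum>z\<leftarrow>p. X z \<omega>) \<in> borel_measurable M"
    by (induction p) (auto intro: X borel_measurable_add)
qed

lemma borel_measurable_exit_term_pos:
  assumes "k > 0" and X: "\<And>s. s \<in> bulk \<union> axis1 \<Longrightarrow> X s \<in> borel_measurable M"
  shows "(\<lambda>\<omega>. exit_term (\<lambda>s. X s \<omega>) y k) \<in> borel_measurable M"
proof -
  have [measurable]: "(\<lambda>\<omega>. lpp (\<lambda>s. X s \<omega>) (k, 1) y) \<in> borel_measurable M"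
    using assms by (intro borel_measurable_lpp) (auto simp: bulk_def)
  have [measurable]: "X (i, 0) \<in> borel_measurable M" if "i \<in> {1..k}" for i
    using that by (intro X) (auto simp: axis1_def)
  show ?thesis using assms(1) by (simp add: exit_term_def)
qed

lemma borel_measurable_exit_term:
  assumes "k \<noteq> 0" and X: "\<And>s. s \<in> sites \<Longrightarrow> X s \<in> borel_measurable M"
  shows "(\<lambda>\<omega>. exit_term (\<lambda>s. X s \<omega>) y k) \<in> borel_measurable M"
proof (cases "k > 0")
  case False
  then have "(\<lambda>\<omega>. exit_term (\<lambda>s. flip X s \<omega>) (prod.swap y) (- k)) \<in> borel_measurable M"
    using assms by (intro borel_measurable_exit_term_pos)
      (auto simp: flip_def sites_iff bulk_def axis1_def intro!: X)
  moreover have "(\<lambda>s. flip X s \<omega>) = flip (\<lambda>s. X s \<omega>)" for \<omega> by (auto simp: flip_def)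
  ultimately show ?thesis using assms(1) by (simp add: exit_term_flip)
qed (use X in \<open>auto simp: sites_def intro: borel_measurable_exit_term_pos\<close>)

lemma borel_measurable_row_max:
  assumes X: "\<And>s. s \<in> bulk \<union> axis1 \<Longrightarrow> X s \<in> borel_measurable M"
  shows "(\<lambda>\<omega>. row_max (\<lambda>s. X s \<omega>) m n) \<in> borel_measurable M"
  unfolding row_max_def
  by (intro borel_measurable_Max borel_measurable_exit_term_pos X) auto

lemma borel_measurable_passage:
  assumes X: "\<And>s. s \<in> sites \<Longrightarrow> X s \<in> borel_measurable M"
  shows "(\<lambda>\<omega>. passage (\<lambda>s. X s \<omega>) i j) \<in> borel_measurable M"
  by (induction "\<lambda>_ :: int \<times> int. 0 :: real" i j rule: passage.induct)
     (auto intro!: borel_measurable_add borel_measurable_max X simp: sites_iff)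

lemma sets_exits:
  assumes "z \<in> bulk" and X: "\<And>s. s \<in> sites \<Longrightarrow> X s \<in> borel_measurable M"
  shows "{\<omega> \<in> space M. exits (\<lambda>s. X s \<omega>) z k} \<in> sets M"
proof -
  obtain m n where z: "z = (int m, int n)" "1 \<le> m" "1 \<le> n" using assms(1) by (rule bulkE)
  have "{\<omega> \<in> space M. exits (\<lambda>s. X s \<omega>) z k} =
     (if k \<in> {- int n..int m} - {0}
      then {\<omega> \<in> space M. exit_term (\<lambda>s. X s \<omega>) z k = passage (\<lambda>s. X s \<omega>) m n} else {})"
    using z by (auto simp: exits_iff)
  moreover have "{\<omega> \<in> space M. exit_term (\<lambda>s. X s \<omega>) z k = passage (\<lambda>s. X s \<omega>) m n} \<in> sets M"
    if "k \<noteq> 0"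
    using borel_measurable_exit_term[OF that X] borel_measurable_passage[OF X]
    by (intro borel_measurable_eq) auto
  ultimately show ?thesis by auto
qed

text \<open>
  The choice depends only on which of the finitely many predicates hold.
\<close>
lemma sets_some:
  assumes "finite R" "\<And>k. k \<in> R \<Longrightarrow> {x \<in> space M. f k x} \<in> sets M"
  shows "{x \<in> space M. Q (SOME k. k \<in> R \<and> f k x)} \<in> sets M"
proof -
  have *: "{x \<in> space M. Q (SOME k. k \<in> R \<and> f k x)} =
    (\<Union>S\<in>{S. S \<subseteq> R \<and> Q (SOME k. k \<in> S)}. {x \<in> space M. \<forall>k\<in>R. f k x \<longleftrightarrow> k \<in> S})"
    (is "?l = ?r")
  proof (intro set_eqI iffI)
    fix x assume "x \<in> ?l"
    then show "x \<in> ?r" by (intro UN_I[of "{k \<in> R. f k x}"]) auto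
  next
    fix x assume "x \<in> ?r"
    then obtain S where S: "S \<subseteq> R" "Q (SOME k. k \<in> S)" "x \<in> space M" "\<forall>k\<in>R. f k x \<longleftrightarrow> k \<in> S" by auto
    then have "(\<lambda>k. k \<in> R \<and> f k x) = (\<lambda>k. k \<in> S)" by auto
    with S show "x \<in> ?l" by simp
  qed
  have "{x \<in> space M. \<forall>k\<in>R. f k x \<longleftrightarrow> k \<in> S} \<in> sets M" for S
  proof (rule sets.sets_Collect_finite_All)
    show "{x \<in> space M. f k x = (k \<in> S)} \<in> sets M" if "k \<in> R" for k
    proof (cases "k \<in> S")
      case False
      have "{x \<in> space M. f k x = (k \<in> S)} = space M - {x \<in> space M. f k x}" using False by auto
      then show ?thesis using assms(2)[OF that] by auto
    qed (use assms(2)[OF that] in simp)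
  qed (use assms in auto)
  then show ?thesis unfolding * using assms(1) by (intro sets.finite_UN) auto
qed

lemma exit_time_eq_some: "exit_time w y = (SOME k. k \<in> {- snd y..fst y} - {0} \<and> exits w y k)"
  unfolding exit_time_def exits_def by (rule arg_cong[where f=Eps]) auto

text \<open>
  The event of the theorem for an arbitrary maximizer instead of the chosen one.
\<close>
definition near :: "int \<times> int \<Rightarrow> real \<Rightarrow> (int \<times> int \<Rightarrow> real) \<Rightarrow> bool" where
  "near v l w \<longleftrightarrow> (\<exists>z\<in>bulk - {0..v}. \<exists>k. real_of_int \<bar>k\<bar> \<le> l \<and> exits w z k)"

lemma sets_near:
  assumes X: "\<And>s. s \<in> sites \<Longrightarrow> X s \<in> borel_measurable M"
  shows "{\<omega> \<in> space M. near v l (\<lambda>s. X s \<omega>)} \<in> sets M"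
proof -
  have "{\<omega> \<in> space M. near v l (\<lambda>s. X s \<omega>)} =
    (\<Union>z\<in>bulk - {0..v}. \<Union>k\<in>{k. real_of_int \<bar>k\<bar> \<le> l}. {\<omega> \<in> space M. exits (\<lambda>s. X s \<omega>) z k})"
    by (auto simp: near_def)
  also have "\<dots> \<in> sets M"
    by (intro sets.countable_UN'' sets_exits X) auto
  finally show ?thesis .
qed

lemma sets_exit_time:
  assumes X: "\<And>s. s \<in> sites \<Longrightarrow> X s \<in> borel_measurable M"
  shows "{\<omega> \<in> space M. \<exists>z\<in>bulk - {0..v}. real_of_int \<bar>exit_time (\<lambda>s. X s \<omega>) z\<bar> \<le> l} \<in> sets M"
proof -
  have "{\<omega> \<in> space M. \<exists>z\<in>bulk - {0..v}. real_of_int \<bar>exit_time (\<lambda>s. X s \<omega>) z\<bar> \<le> l} =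
    (\<Union>z\<in>bulk - {0..v}. {\<omega> \<in> space M. real_of_int \<bar>exit_time (\<lambda>s. X s \<omega>) z\<bar> \<le> l})"
    by auto
  also have "\<dots> \<in> sets M"
    unfolding exit_time_eq_some
    by (intro sets.countable_UN'' sets_some[where Q="\<lambda>k. real_of_int \<bar>k\<bar> \<le> l"] sets_exits X) auto
  finally show ?thesis .
qed

lemma stationary_measurable:
  "stationary_weights P \<rho> W \<Longrightarrow> s \<in> sites \<Longrightarrow> W s \<in> borel_measurable P"
  using distributed_measurable[of P lborel "W s" "exponential_density (rate \<rho> s)"]
  by (simp add: stationary_weights_iff)

lemma stationary_law:
  assumes W: "stationary_weights P \<rho> W"
  shows "distr P (PiM sites (\<lambda>_. borel)) (\<lambda>x. \<lambda>s\<in>sites. W s x) =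
     PiM sites (\<lambda>s. density lborel (exponential_density (rate \<rho> s)))"
proof -
  interpret prob_space P using W by (simp add: stationary_weights_iff)
  have ne: "sites \<noteq> {}" by (auto simp: sites_def axis1_def intro: exI[of _ 1])
  have "distr P (PiM sites (\<lambda>_. borel)) (\<lambda>x. \<lambda>s\<in>sites. W s x) = PiM sites (\<lambda>s. distr P borel (W s))"
    using W ne stationary_measurable[OF W]
    by (subst indep_vars_iff_distr_eq_PiM'[symmetric]) (auto simp: stationary_weights_iff)
  also have "\<dots> = PiM sites (\<lambda>s. density lborel (exponential_density (rate \<rho> s)))"
  proof (rule PiM_cong[OF refl])
    fix s assume "s \<in> sites"
    then have "distr P lborel (W s) = density lborel (exponential_density (rate \<rho> s))"
      using W by (intro distributed_distr_eq_density) (auto simp: stationary_weights_iff)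
    then show "distr P borel (W s) = density lborel (exponential_density (rate \<rho> s))"
      by (simp cong: distr_cong)
  qed
  finally show ?thesis .
qed

text \<open>
  The right-hand side does not mention \<open>P\<close> and \<open>W\<close>: all stationary models with
  the same parameter give this event the same probability, in particular a model and its shifts.
\<close>
lemma prob_near_law:
  assumes W: "stationary_weights P \<rho> W"
  shows "measure P {x \<in> space P. near v l (\<lambda>s. W s x)} =
    measure (PiM sites (\<lambda>s. density lborel (exponential_density (rate \<rho> s))))
      {g \<in> space (PiM sites (\<lambda>_. borel)). near v l g}"
proof -
  let ?S = "PiM sites (\<lambda>_. borel :: real measure)"
  have N: "{g \<in> space ?S. near v l g} \<in> sets ?S"
    by (rule sets_near[where X="\<lambda>s g. g s"]) auto
  have "near v l (\<lambda>s. W s x) = near v l (\<lambda>s\<in>sites. W s x)" for x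
    unfolding near_def by (intro bex_cong ex_cong1 conj_cong refl exits_cong) auto
  then have "{x \<in> space P. near v l (\<lambda>s. W s x)} =
      (\<lambda>x. \<lambda>s\<in>sites. W s x) -` {g \<in> space ?S. near v l g} \<inter> space P"
    by (auto simp: space_PiM)
  then show ?thesis
    unfolding stationary_law[OF W, symmetric]
    using N stationary_measurable[OF W]
    by (subst measure_distr) (auto intro!: measurable_restrict)
qed

section \<open>Almost sure uniqueness of the exit point\<close>

text \<open>
  An exponential variable has no atoms, so an independent variable misses it almost surely.
\<close>
lemma (in prob_space) AE_neq_independent:
  assumes W: "indep_vars (\<lambda>_. borel) W S" and s: "s \<in> S"
    and d: "distributed M lborel (W s) (exponential_density a)"
    and Q [measurable]: "Q \<in> borel_measurable (PiM (S - {s}) (\<lambda>_. borel))"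
  shows "AE x in M. W s x \<noteq> Q (\<lambda>t\<in>S - {s}. W t x)"
proof -
  let ?Y = "\<lambda>x. Q (\<lambda>t\<in>S - {s}. W t x)"
  have [measurable]: "random_variable borel (W t)" if "t \<in> S" for t
    using W that by (simp add: indep_vars_def2)
  note [measurable] = s
  have [measurable]: "random_variable borel ?Y" by measurable
  have "indep_var (PiM {s} (\<lambda>_. borel)) (\<lambda>x. restrict (\<lambda>t. W t x) {s})
      (PiM (S - {s}) (\<lambda>_. borel)) (\<lambda>x. restrict (\<lambda>t. W t x) (S - {s}))"
    by (rule indep_var_restrict[OF W]) (use s in auto)
  then have "indep_var borel ((\<lambda>g. g s) \<circ> (\<lambda>x. restrict (\<lambda>t. W t x) {s}))
      borel (Q \<circ> (\<lambda>x. restrict (\<lambda>t. W t x) (S - {s})))"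
    by (rule indep_var_compose) auto
  then have "indep_var borel (W s) borel ?Y" by (simp add: comp_def)
  then have joint: "distr M borel (W s) \<Otimes>\<^sub>M distr M borel ?Y =
      distr M (borel \<Otimes>\<^sub>M borel) (\<lambda>x. (W s x, ?Y x))"
    by (simp add: indep_var_distribution_eq)
  interpret X: prob_space "distr M borel (W s)" by (rule prob_space_distr) measurable
  interpret Y: prob_space "distr M borel ?Y" by (rule prob_space_distr) measurable
  interpret XY: pair_sigma_finite "distr M borel (W s)" "distr M borel ?Y" ..
  have "distr M borel (W s) = density lborel (exponential_density a)"
    using distributed_distr_eq_density[OF d] by (simp cong: distr_cong)
  then have null: "emeasure (distr M borel (W s)) {y} = 0" for y
    by (simp add: emeasure_density nn_integral_indicator_singleton')
  let ?D = "{p :: real \<times> real. fst p = snd p}"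
  have D [measurable]: "?D \<in> sets (borel \<Otimes>\<^sub>M borel)"
    using borel_measurable_eq[of fst "borel \<Otimes>\<^sub>M borel :: (real \<times> real) measure" snd] by (simp add: space_pair_measure)
  have "emeasure M {x \<in> space M. W s x = ?Y x} = emeasure (distr M (borel \<Otimes>\<^sub>M borel) (\<lambda>x. (W s x, ?Y x))) ?D"
    by (subst emeasure_distr) (auto intro!: arg_cong[where f="emeasure M"] D)
  also have "\<dots> = (\<integral>\<^sup>+y. emeasure (distr M borel (W s)) ((\<lambda>x. (x, y)) -` ?D) \<partial>distr M borel ?Y)"
    unfolding joint[symmetric] by (rule XY.emeasure_pair_measure_alt2) simp
  also have "\<dots> = 0"
    by (simp add: null vimage_def)
  finally have "emeasure M {x \<in> space M. W s x = ?Y x} = 0" .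
  then show ?thesis
    by (subst AE_iff_measurable[OF _ refl]) auto
qed

lemma exit_term_upd_eq:
  assumes "k > 0"
  shows "exit_term (w((k, 0) := 0)) y k = exit_term w y k - w (k, 0)"
proof -
  have "lpp (w((k, 0) := 0)) (k, 1) y = lpp w (k, 1) y"
    by (rule lpp_cong) (use assms in \<open>auto simp: bulk_def\<close>)
  moreover have "{1..k} = insert k {1..k - 1}" using assms by auto
  ultimately show ?thesis using assms by (simp add: exit_term_def)
qed

lemma exit_term_upd_less:
  assumes "k < k'" "k \<noteq> 0" "k' > 0"
  shows "exit_term (w((k', 0) := 0)) y k = exit_term w y k"
proof -
  have "lpp (w((k', 0) := 0)) (k, 1) y = lpp w (k, 1) y" if "k > 0"
    by (rule lpp_cong) (use assms that in \<open>auto simp: bulk_def\<close>)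
  moreover have "lpp (w((k', 0) := 0)) (1, -k) y = lpp w (1, -k) y" if "k < 0"
    by (rule lpp_cong) (use assms that in \<open>auto simp: bulk_def\<close>)
  ultimately show ?thesis using assms by (simp add: exit_term_def)
qed

text \<open>
  The later of two exits uses the boundary weight at \<open>(k', 0)\<close>, on which the earlier one does
  not depend. Setting this weight to \<open>0\<close> isolates it as the only dependence of the difference.
\<close>
lemma exit_terms_differ_pos:
  assumes W: "stationary_weights P \<rho> W" and k: "k < k'" "k \<noteq> 0" "k' > 0"
  shows "AE x in P. exit_term (\<lambda>s. W s x) y k \<noteq> exit_term (\<lambda>s. W s x) y k'"
proof -
  interpret prob_space P using W by (simp add: stationary_weights_iff)
  let ?s = "(k', 0 :: int)"
  have s: "?s \<in> sites" using k by (simp add: sites_iff)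
  \<comment> \<open>As a function of all weights except the one at \<open>?s\<close>: the value that this weight must take for a tie.\<close>
  define Q where "Q g = exit_term (g(?s := 0)) y k - exit_term (g(?s := 0)) y k'" for g :: "int \<times> int \<Rightarrow> real"
  have "Q \<in> borel_measurable (PiM (sites - {?s}) (\<lambda>_. borel))"
    unfolding Q_def fun_upd_def using k
  proof (intro borel_measurable_diff borel_measurable_exit_term)
    show "(\<lambda>g. if s = ?s then 0 else g s) \<in> borel_measurable (PiM (sites - {?s}) (\<lambda>_. borel))"
      if "s \<in> sites" for s
      using that by (cases "s = ?s") auto
    then show "(\<lambda>g. if s = ?s then 0 else g s) \<in> borel_measurable (PiM (sites - {?s}) (\<lambda>_. borel))"
      if "s \<in> sites" for s
      using that .
  qed auto
  then have "AE x in P. W ?s x \<noteq> Q (\<lambda>t\<in>sites - {?s}. W t x)"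
    by (intro AE_neq_independent s) (use W s in \<open>auto simp: stationary_weights_iff\<close>)
  moreover have "Q (\<lambda>t\<in>sites - {?s}. W t x) = exit_term (\<lambda>s. W s x) y k - (exit_term (\<lambda>s. W s x) y k' - W ?s x)" for x
  proof -
    have "exit_term ((\<lambda>t\<in>sites - {?s}. W t x)(?s := 0)) y j = exit_term ((\<lambda>s. W s x)(?s := 0)) y j" if "j \<noteq> 0" for j
      by (rule exit_term_cong) (use that in auto)
    then show ?thesis
      using k by (simp add: Q_def exit_term_upd_eq exit_term_upd_less)
  qed
  ultimately show ?thesis by auto
qed

lemma flip_fun: "(\<lambda>s. flip W s x) = flip (\<lambda>s. W s x)"
  by (simp add: flip_def fun_eq_iff)

lemma exit_terms_differ:
  assumes W: "stationary_weights P \<rho> W" and k: "k \<noteq> k'" "k \<noteq> 0" "k' \<noteq> 0"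
  shows "AE x in P. exit_term (\<lambda>s. W s x) y k \<noteq> exit_term (\<lambda>s. W s x) y k'"
proof -
  have *: "AE x in P. exit_term (\<lambda>s. W s x) y k \<noteq> exit_term (\<lambda>s. W s x) y k'"
    if k: "k < k'" "k \<noteq> 0" "k' \<noteq> 0" for k k'
  proof (cases "k' > 0")
    case False
    then show ?thesis
      using exit_terms_differ_pos[OF stationary_flip[OF W], of "- k'" "- k" "prod.swap y"] k
      by (auto simp: flip_fun exit_term_flip)
  qed (use exit_terms_differ_pos[OF W] k in auto)
  show ?thesis
  proof (cases "k < k'")
    case False
    then show ?thesis using *[of k' k] k by auto
  qed (use * k in auto)
qed

lemma exits_unique:
  assumes W: "stationary_weights P \<rho> W"
  shows "AE x in P. \<forall>z k k'. exits (\<lambda>s. W s x) z k \<longrightarrow> exits (\<lambda>s. W s x) z k' \<longrightarrow> k = k'"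
proof -
  have "AE x in P. exits (\<lambda>s. W s x) z k \<longrightarrow> exits (\<lambda>s. W s x) z k' \<longrightarrow> k = k'" for z k k'
  proof (cases "k \<noteq> k' \<and> k \<noteq> 0 \<and> k' \<noteq> 0")
    case True
    then show ?thesis using exit_terms_differ[OF W, of k k' z] by (auto simp: exits_def)
  qed (auto simp: exits_def)
  then show ?thesis unfolding AE_all_countable by blast
qed

lemma prob_near_le:
  assumes W: "stationary_weights P \<rho> W"
  shows "measure P {x \<in> space P. near v l (\<lambda>s. W s x)} \<le>
    measure P {x \<in> space P. \<exists>z\<in>bulk - {0..v}. real_of_int \<bar>exit_time (\<lambda>s. W s x) z\<bar> \<le> l}"
proof -
  interpret prob_space P using W by (simp add: stationary_weights_iff)
  show ?thesis
  proof (rule finite_measure_mono_AE)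
    show "{x \<in> space P. \<exists>z\<in>bulk - {0..v}. real_of_int \<bar>exit_time (\<lambda>s. W s x) z\<bar> \<le> l} \<in> events"
      by (rule sets_exit_time[OF stationary_measurable[OF W]])
    have *: "exit_time w z = k" if "exits w z k" "\<forall>k k'. exits w z k \<longrightarrow> exits w z k' \<longrightarrow> k = k'" for w z k
      unfolding exit_time_eq_some
      by (rule some_equality) (use that in \<open>auto simp: exits_def[of w z k]\<close>)
    show "AE x in P. x \<in> {x \<in> space P. near v l (\<lambda>s. W s x)} \<longrightarrow>
       x \<in> {x \<in> space P. \<exists>z\<in>bulk - {0..v}. real_of_int \<bar>exit_time (\<lambda>s. W s x) z\<bar> \<le> l}"
      using exits_unique[OF W]
    proof eventually_elim
      case (elim x)
      then show ?case unfolding near_def using * by blast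
    qed
  qed
qed

section \<open>Exponential moments\<close>

lemma (in prob_space) exponential_mgf:
  assumes X: "distributed M lborel X (exponential_density a)" and a: "0 < a" "\<theta> < a"
  shows "(\<integral>\<^sup>+x. ennreal (exp (\<theta> * X x)) \<partial>M) = ennreal (a / (a - \<theta>))"
proof -
  have real: "exponential_density a y * exp (\<theta> * y) = a / (a - \<theta>) * exponential_density (a - \<theta>) y" for y
  proof -
    have "exp (- y * a) * exp (\<theta> * y) = exp (- y * (a - \<theta>))"
      by (simp add: exp_add[symmetric] algebra_simps)
    then show ?thesis using a by (simp add: exponential_density_def)
  qed
  have "(\<integral>\<^sup>+x. ennreal (exp (\<theta> * X x)) \<partial>M) = (\<integral>\<^sup>+y. expd a y * ennreal (exp (\<theta> * y)) \<partial>lborel)"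
    by (rule distributed_nn_integral[OF X, symmetric]) simp
  also have "\<dots> = (\<integral>\<^sup>+y. ennreal (a / (a - \<theta>)) * expd (a - \<theta>) y \<partial>lborel)"
    using a real by (simp add: ennreal_mult'[symmetric] exponential_density_nonneg)
  also have "\<dots> = ennreal (a / (a - \<theta>))"
    using a by (simp add: nn_integral_cmult nn_integral_expd)
  finally show ?thesis .
qed

lemma passage_row_mgf:
  assumes W: "stationary_weights P \<rho> W" and \<rho>: "\<rho> < 1" and \<theta>: "\<theta> < 1 - \<rho>"
  shows "(\<integral>\<^sup>+x. ennreal (exp (\<theta> * passage (\<lambda>s. W s x) k 0)) \<partial>P) = ennreal (((1 - \<rho>) / (1 - \<rho> - \<theta>)) ^ k)"
proof -
  interpret prob_space P using W by (simp add: stationary_weights_iff)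
  let ?h = "\<lambda>i::nat. (int i, 0 :: int)"
  have mem: "?h i \<in> sites" if "i \<in> {1..k}" for i using that by (simp add: sites_iff)
  have "indep_vars (\<lambda>_. borel) W (?h ` {1..k})"
    by (rule indep_vars_subset[of _ _ sites]) (use W mem in \<open>auto simp: stationary_weights_iff\<close>)
  then have "indep_vars (\<lambda>_. borel) (\<lambda>i. W (?h i)) {1..k}"
    by (rule indep_vars_reindex) (auto simp: inj_on_def)
  then have ind: "indep_vars (\<lambda>_. borel) (\<lambda>i x. ennreal (exp (\<theta> * W (?h i) x))) {1..k}"
    by (rule indep_vars_compose2) simp
  have "(\<integral>\<^sup>+x. ennreal (exp (\<theta> * passage (\<lambda>s. W s x) k 0)) \<partial>P) =
      (\<integral>\<^sup>+x. (\<Prod>i\<in>{1..k}. ennreal (exp (\<theta> * W (?h i) x))) \<partial>P)"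
    by (simp add: passage_row sum_distrib_left exp_sum prod_ennreal)
  also have "\<dots> = (\<Prod>i\<in>{1..k}. \<integral>\<^sup>+x. ennreal (exp (\<theta> * W (?h i) x)) \<partial>P)"
    by (rule indep_vars_nn_integral[OF _ ind]) auto
  also have "\<dots> = (\<Prod>i\<in>{1..k}. ennreal ((1 - \<rho>) / (1 - \<rho> - \<theta>)))"
  proof (rule prod.cong[OF refl])
    fix i assume "i \<in> {1..k}"
    then have "distributed P lborel (W (?h i)) (exponential_density (1 - \<rho>))"
      using W mem[of i] by (auto simp: stationary_weights_iff rate_def)
    then show "(\<integral>\<^sup>+x. ennreal (exp (\<theta> * W (?h i) x)) \<partial>P) = ennreal ((1 - \<rho>) / (1 - \<rho> - \<theta>))"
      using \<rho> \<theta> by (intro exponential_mgf) auto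
  qed
  finally show ?thesis using \<rho> \<theta> by (simp add: ennreal_power)
qed

lemma passage_row_mean:
  assumes W: "stationary_weights P \<rho> W" and \<rho>: "\<rho> < 1"
  shows "integrable P (\<lambda>x. passage (\<lambda>s. W s x) k 0)"
    and "(\<integral>x. passage (\<lambda>s. W s x) k 0 \<partial>P) = k / (1 - \<rho>)"
proof -
  interpret prob_space P using W by (simp add: stationary_weights_iff)
  have e: "expectation (W (int i, 0)) = 1 / (1 - \<rho>)" if "i \<in> {1..k}" for i
  proof (rule exponential_distributed_expectation)
    have "(int i, 0) \<in> sites" using that by (simp add: sites_iff)
    then show "distributed P lborel (W (int i, 0)) (exponential_density (1 - \<rho>))"
      using W by (auto simp: stationary_weights_iff rate_def)
  qed (use \<rho> in simp)
  then have i: "integrable P (W (int i, 0))" if "i \<in> {1..k}" for i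
    using that \<rho> not_integrable_integral_eq[of P "W (int i, 0)"] by fastforce
  show "integrable P (\<lambda>x. passage (\<lambda>s. W s x) k 0)"
    unfolding passage_row by (intro Bochner_Integration.integrable_sum i)
  show "(\<integral>x. passage (\<lambda>s. W s x) k 0 \<partial>P) = k / (1 - \<rho>)"
    unfolding passage_row using e i by (subst Bochner_Integration.integral_sum) auto
qed

text \<open>
  Burke's theorem in the vertical direction: the increments along the horizontal line at height
  \<open>n\<close> are the boundary weights of the reflected, shifted and reflected model.
\<close>
lemma stationary_top_row:
  assumes W: "stationary_weights P \<rho> W" and \<rho>: "0 < \<rho>" "\<rho> < 1"
  shows "stationary_weights P \<rho> (\<lambda>z x. flip ((shift ^^ n) (flip (\<lambda>s. W s x))) z)"
proof -
  have "stationary_weights P (1 - \<rho>) (\<lambda>z x. (shift ^^ n) (\<lambda>s. flip W s x) z)"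
    using \<rho> by (intro stationary_shift_iter stationary_flip W) auto
  moreover have "flip (\<lambda>z x. A x z) = (\<lambda>z x. flip (A x) z)" for A :: "'a \<Rightarrow> int \<times> int \<Rightarrow> real"
    by (simp add: flip_def fun_eq_iff)
  ultimately show ?thesis
    using stationary_flip[of P "1 - \<rho>" "\<lambda>z x. (shift ^^ n) (\<lambda>s. flip W s x) z"] by (simp add: flip_fun)
qed

lemma passage_top_row:
  "passage (flip ((shift ^^ n) (flip w))) m 0 = passage w m n - passage w 0 n"
  by (simp add: passage_flip passage_shift_iter)

lemma passage_mean:
  assumes W: "stationary_weights P \<rho> W" and \<rho>: "0 < \<rho>" "\<rho> < 1"
  shows "integrable P (\<lambda>x. passage (\<lambda>s. W s x) m n)"
    and "(\<integral>x. passage (\<lambda>s. W s x) m n \<partial>P) = m / (1 - \<rho>) + n / \<rho>"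
proof -
  have eq: "passage (\<lambda>s. W s x) m n = passage (\<lambda>s. flip W s x) n 0
      + passage (\<lambda>z. flip ((shift ^^ n) (flip (\<lambda>s. W s x))) z) m 0" for x
    using passage_top_row[of n "\<lambda>s. W s x" m] by (simp add: flip_fun passage_flip)
  note 1 = passage_row_mean[OF stationary_flip[OF W], of n]
  note 2 = passage_row_mean[OF stationary_top_row[OF W \<rho>, of n], of m]
  show "integrable P (\<lambda>x. passage (\<lambda>s. W s x) m n)"
    unfolding eq using 1 2 \<rho> by (intro Bochner_Integration.integrable_add) auto
  show "(\<integral>x. passage (\<lambda>s. W s x) m n \<partial>P) = m / (1 - \<rho>) + n / \<rho>"
    unfolding eq using 1 2 \<rho> by (subst Bochner_Integration.integral_add) auto
qed

lemma row_max_cong: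
  assumes "\<And>s. s \<in> bulk \<union> axis1 \<Longrightarrow> w s = w' s"
  shows "row_max w m n = row_max w' m n"
proof -
  have "exit_term w y (int k) = exit_term w' y (int k)" if "k \<in> {1..m}" for k y
  proof -
    have "lpp w (int k, 1) y = lpp w' (int k, 1) y"
      using assms that by (intro lpp_cong) (auto simp: bulk_def)
    then show ?thesis using assms that
      by (auto simp: exit_term_row passage_row axis1_def)
  qed
  then show ?thesis unfolding row_max_def by (intro arg_cong[where f=Max] image_cong refl) auto
qed

text \<open>
  The main moment bound. The passage time \<open>row_max\<close> is independent of the sum of the first \<open>n\<close> vertical
  boundary weights, and their difference is at most the sum of the increments along the top row.
\<close>
lemma row_max_mgf:
  assumes W: "stationary_weights P \<rho> W" and \<rho>: "0 < \<rho>" "\<rho> < 1"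
    and t: "0 < t" "t < 1 - \<rho>" and mn: "1 \<le> m" "1 \<le> n"
  shows "(\<integral>\<^sup>+x. ennreal (exp (t * row_max (\<lambda>s. W s x) m n)) \<partial>P) \<le>
    ennreal (((\<rho> + t) / \<rho>) ^ n * ((1 - \<rho>) / (1 - \<rho> - t)) ^ m)"
proof -
  interpret prob_space P using W by (simp add: stationary_weights_iff)
  let ?A = "bulk \<union> axis1"
  define f1 where "f1 = (\<lambda>g. ennreal (exp (t * row_max g m n)))"
  define f2 where "f2 = (\<lambda>g. ennreal (exp (- t * passage g 0 n)))"
  define X where "X = (\<lambda>x. ennreal (exp (t * row_max (\<lambda>s. W s x) m n)))"
  define Y where "Y = (\<lambda>x. ennreal (exp (- t * passage (\<lambda>s. W s x) 0 n)))"
  have f1: "f1 \<in> borel_measurable (PiM ?A (\<lambda>_. borel))"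
    unfolding f1_def
    by (intro measurable_compose[OF _ measurable_ennreal] borel_measurable_exp
        measurable_compose[OF _ borel_measurable_exp] borel_measurable_times borel_measurable_const
        borel_measurable_row_max[where X="\<lambda>s g. g s"]) auto
  have "(\<lambda>g. g (0, int i)) \<in> borel_measurable (PiM axis2 (\<lambda>_. borel :: real measure))" if "i \<in> {1..n}" for i
    using that by (intro measurable_component_singleton) (auto simp: axis2_def)
  then have f2: "f2 \<in> borel_measurable (PiM axis2 (\<lambda>_. borel))"
    unfolding f2_def passage_col by measurable
  have "indep_var (PiM ?A (\<lambda>_. borel)) (\<lambda>x. restrict (\<lambda>s. W s x) ?A)
      (PiM axis2 (\<lambda>_. borel)) (\<lambda>x. restrict (\<lambda>s. W s x) axis2)"
    by (rule indep_var_restrict[of _ _ sites])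
      (use W in \<open>auto simp: stationary_weights_iff sites_def bulk_def axis1_def axis2_def\<close>)
  then have "indep_var borel (f1 \<circ> (\<lambda>x. restrict (\<lambda>s. W s x) ?A)) borel (f2 \<circ> (\<lambda>x. restrict (\<lambda>s. W s x) axis2))"
    by (rule indep_var_compose[OF _ f1 f2])
  moreover have "f1 \<circ> (\<lambda>x. restrict (\<lambda>s. W s x) ?A) = X"
    by (auto simp: f1_def X_def fun_eq_iff intro!: arg_cong[where f=ennreal] row_max_cong)
  moreover have "f2 \<circ> (\<lambda>x. restrict (\<lambda>s. W s x) axis2) = Y"
    by (auto simp: f2_def Y_def fun_eq_iff passage_col axis2_def)
  ultimately have "indep_var borel X borel Y" by simp
  moreover have "case_bool borel borel = (\<lambda>_. borel :: ennreal measure)" by (simp add: fun_eq_iff split: bool.split)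
  ultimately have "indep_vars (\<lambda>_. borel) (case_bool X Y) UNIV" by (simp add: indep_var_def)
  from indep_vars_nn_integral[OF _ this]
  have "(\<integral>\<^sup>+x. X x \<partial>P) * (\<integral>\<^sup>+x. Y x \<partial>P) = (\<integral>\<^sup>+x. X x * Y x \<partial>P)"
    by (simp add: UNIV_bool mult.commute)
  also have "\<dots> \<le> (\<integral>\<^sup>+x. ennreal (exp (t * passage (\<lambda>z. flip ((shift ^^ n) (flip (\<lambda>s. W s x))) z) m 0)) \<partial>P)"
  proof (rule nn_integral_mono)
    fix x
    have "row_max (\<lambda>s. W s x) m n - passage (\<lambda>s. W s x) 0 n \<le>
        passage (\<lambda>z. flip ((shift ^^ n) (flip (\<lambda>s. W s x))) z) m 0"
      using row_max_le_passage[OF mn] by (simp add: passage_top_row)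
    then have "t * (row_max (\<lambda>s. W s x) m n - passage (\<lambda>s. W s x) 0 n) \<le>
        t * passage (\<lambda>z. flip ((shift ^^ n) (flip (\<lambda>s. W s x))) z) m 0"
      using t by simp
    then show "X x * Y x \<le> ennreal (exp (t * passage (\<lambda>z. flip ((shift ^^ n) (flip (\<lambda>s. W s x))) z) m 0))"
      by (simp add: X_def Y_def ennreal_mult[symmetric] exp_add[symmetric] right_diff_distrib)
  qed
  also have "\<dots> = ennreal (((1 - \<rho>) / (1 - \<rho> - t)) ^ m)"
    by (rule passage_row_mgf[OF stationary_top_row[OF W \<rho>] \<rho>(2) t(2)])
  finally have le: "(\<integral>\<^sup>+x. X x \<partial>P) * (\<integral>\<^sup>+x. Y x \<partial>P) \<le> ennreal (((1 - \<rho>) / (1 - \<rho> - t)) ^ m)" .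
  have "(\<integral>\<^sup>+x. Y x \<partial>P) = ennreal ((\<rho> / (\<rho> + t)) ^ n)"
    using passage_row_mgf[OF stationary_flip[OF W], of "- t" n] \<rho> t
    by (simp add: Y_def flip_fun passage_flip)
  then have "(\<integral>\<^sup>+x. X x \<partial>P) * ennreal ((\<rho> / (\<rho> + t)) ^ n) * ennreal (((\<rho> + t) / \<rho>) ^ n) \<le>
      ennreal (((1 - \<rho>) / (1 - \<rho> - t)) ^ m) * ennreal (((\<rho> + t) / \<rho>) ^ n)"
    using le by (intro mult_right_mono) auto
  moreover have "ennreal ((\<rho> / (\<rho> + t)) ^ n) * ennreal (((\<rho> + t) / \<rho>) ^ n) = 1"
    using \<rho> t by (simp add: ennreal_mult[symmetric] power_mult_distrib[symmetric])
  ultimately show ?thesis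
    using \<rho> t by (simp add: X_def ennreal_mult'[symmetric] mult.assoc) (simp add: mult.commute)
qed

lemma (in prob_space) chernoff:
  assumes [measurable]: "Z \<in> borel_measurable M" and Z: "(\<integral>\<^sup>+x. ennreal (exp (Z x)) \<partial>M) \<le> ennreal (exp c)"
  shows "prob {x \<in> space M. b \<le> Z x} \<le> exp (c - b)"
proof -
  have "emeasure M {x \<in> space M. b \<le> Z x} \<le> emeasure M {x\<in>space M. 1 \<le> ennreal (exp (- b)) * ennreal (exp (Z x))}"
    by (intro emeasure_mono) (auto simp: ennreal_mult[symmetric] exp_add[symmetric])
  also have "\<dots> \<le> ennreal (exp (- b)) * (\<integral>\<^sup>+x. ennreal (exp (Z x)) * indicator (space M) x \<partial>M)"
    by (rule nn_integral_Markov_inequality) auto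
  also have "(\<integral>\<^sup>+x. ennreal (exp (Z x)) * indicator (space M) x \<partial>M) = (\<integral>\<^sup>+x. ennreal (exp (Z x)) \<partial>M)"
    by (intro nn_integral_cong) auto
  also have "ennreal (exp (- b)) * \<dots> \<le> ennreal (exp (- b)) * ennreal (exp c)"
    using Z by (intro mult_left_mono) auto
  also have "\<dots> = ennreal (exp (c - b))" by (simp add: ennreal_mult[symmetric] exp_add[symmetric])
  finally show ?thesis by (simp add: emeasure_eq_measure)
qed

text \<open>
  A centred variable has equal means of its positive and negative parts, so a bound on the upper side
  alone controls the lower tail.
\<close>
lemma (in prob_space) centred_lower_tail:
  assumes Y: "integrable M Y" "expectation Y = 0" and mgf: "(\<integral>\<^sup>+x. ennreal (exp (Y x)) \<partial>M) \<le> ennreal D"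
    and D: "0 \<le> D" and t: "0 < t"
  shows "prob {x \<in> space M. Y x \<le> - t} \<le> D / t"
proof -
  have int: "integrable M (\<lambda>x. max (Y x) 0)" "integrable M (\<lambda>x. max (- Y x) 0)"
    using Y by auto
  have "ennreal (expectation (\<lambda>x. max (Y x) 0)) = (\<integral>\<^sup>+x. ennreal (max (Y x) 0) \<partial>M)"
    by (rule nn_integral_eq_integral[symmetric]) (use int in auto)
  also have "\<dots> \<le> (\<integral>\<^sup>+x. ennreal (exp (Y x)) \<partial>M)"
  proof (intro nn_integral_mono ennreal_leI)
    show "max (Y x) 0 \<le> exp (Y x)" for x
      using exp_ge_add_one_self[of "Y x"] exp_gt_zero[of "Y x"] by linarith
  qed
  also have "\<dots> \<le> ennreal D" by (rule mgf)
  finally have plus: "expectation (\<lambda>x. max (Y x) 0) \<le> D" using D by (simp add: ennreal_le_iff)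
  have "expectation (\<lambda>x. max (Y x) 0) - expectation (\<lambda>x. max (- Y x) 0) = expectation (\<lambda>x. max (Y x) 0 - max (- Y x) 0)"
    using int by simp
  also have "(\<lambda>x. max (Y x) 0 - max (- Y x) 0) = Y" by (auto simp: max_def)
  finally have minus: "expectation (\<lambda>x. max (- Y x) 0) \<le> D" using plus Y by simp
  have "prob {x \<in> space M. Y x \<le> - t} = prob {x \<in> space M. t \<le> max (- Y x) 0}"
    using t by (intro arg_cong[where f=prob]) auto
  also have "\<dots> \<le> expectation (\<lambda>x. max (- Y x) 0) / t"
    by (rule integral_Markov_inequality_measure[OF int(2), where A="{}"]) (use t in auto)
  also have "\<dots> \<le> D / t" using minus t by (simp add: divide_right_mono)
  finally show ?thesis .
qed

section \<open>The scale of the exit point\<close>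

lemma one_plus_le_exp_cubic:
  fixes x :: real assumes "0 \<le> x" shows "1 + x \<le> exp (x - x\<^sup>2 / 2 + x ^ 3 / 3)"
proof -
  define f where "f = (\<lambda>x::real. x - x\<^sup>2 / 2 + x ^ 3 / 3 - ln (1 + x))"
  have "f 0 \<le> f x"
  proof (rule DERIV_nonneg_imp_nondecreasing[OF assms])
    fix y :: real assume y: "0 \<le> y" "y \<le> x"
    have "(f has_real_derivative 1 - y + y\<^sup>2 - 1 / (1 + y)) (at y)"
      unfolding f_def using y by (auto intro!: derivative_eq_intros simp: power2_eq_square)
    moreover have "1 - y + y\<^sup>2 - 1 / (1 + y) = y ^ 3 / (1 + y)"
      using y by (simp add: field_simps power2_eq_square power3_eq_cube)
    ultimately show "\<exists>d. (f has_real_derivative d) (at y) \<and> 0 \<le> d"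
      using y by (intro exI[of _ "y ^ 3 / (1 + y)"]) auto
  qed
  then have "ln (1 + x) \<le> x - x\<^sup>2 / 2 + x ^ 3 / 3" by (simp add: f_def)
  then show ?thesis using assms by (metis add_pos_nonneg exp_le_cancel_iff exp_ln zero_less_one)
qed

lemma geometric_le_exp_cubic:
  fixes x :: real assumes "0 \<le> x" "x \<le> 1 / 2" shows "1 / (1 - x) \<le> exp (x + x\<^sup>2 / 2 + x ^ 3)"
proof -
  define f where "f = (\<lambda>x::real. x + x\<^sup>2 / 2 + x ^ 3 + ln (1 - x))"
  have "f 0 \<le> f x"
  proof (rule DERIV_nonneg_imp_nondecreasing[OF assms(1)])
    fix y :: real assume y: "0 \<le> y" "y \<le> x"
    have "(f has_real_derivative 1 + y + 3 * y\<^sup>2 - 1 / (1 - y)) (at y)"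
      unfolding f_def using y assms by (auto intro!: derivative_eq_intros simp: power2_eq_square)
    moreover have "1 + y + 3 * y\<^sup>2 - 1 / (1 - y) = y\<^sup>2 * (2 - 3 * y) / (1 - y)"
      using y assms by (simp add: field_simps power2_eq_square)
    moreover have "0 \<le> y\<^sup>2 * (2 - 3 * y) / (1 - y)"
      using y assms by (intro divide_nonneg_nonneg mult_nonneg_nonneg) auto
    ultimately show "\<exists>d. (f has_real_derivative d) (at y) \<and> 0 \<le> d"
      by (intro exI[of _ "y\<^sup>2 * (2 - 3 * y) / (1 - y)"]) auto
  qed
  then have "- (x + x\<^sup>2 / 2 + x ^ 3) \<le> ln (1 - x)" by (simp add: f_def)
  then have "exp (- (x + x\<^sup>2 / 2 + x ^ 3)) \<le> 1 - x" using assms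
    by (subst (asm) ln_ge_iff) auto
  then show ?thesis using assms by (simp add: exp_minus field_simps)
qed

text \<open>
  The \<open>O(1)\<close> error of the moment bounds in the characteristic direction. The terms with
  squares come from the rounding of the endpoint, the others from the third order; the form is symmetric
  under \<open>\<rho> \<mapsto> 1 - \<rho>\<close>.
\<close>
definition excess :: "real \<Rightarrow> real" where
  "excess \<rho> = 1 / \<rho>\<^sup>2 + 1 / \<rho> + 1 / \<rho> ^ 3 + 1 / (1 - \<rho>)\<^sup>2 + 1 / (1 - \<rho>) + 1 / (1 - \<rho>) ^ 3"

lemma excess_flip: "excess (1 - \<rho>) = excess \<rho>"
  by (simp add: excess_def)

text \<open>
  The endpoint \<open>(m, n)\<close> is the characteristic point of size \<open>N\<close> up to rounding upwards,
  and \<open>t = N\<^bsup>-1/3\<^esup>\<close> is the inverse fluctuation scale. The bounds on \<open>t\<close> keep \<open>t / \<rho>\<close> and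
  \<open>t / (1 - \<rho>)\<close> below \<open>1/2\<close>.
\<close>
locale characteristic =
  fixes \<rho> N t :: real and m n :: nat
  assumes \<rho>: "0 < \<rho>" "\<rho> < 1"
    and t: "0 < t" "N * t ^ 3 = 1" "t \<le> \<rho> / 2" "t \<le> (1 - \<rho>) / 2"
    and m: "N * (1 - \<rho>)\<^sup>2 \<le> m" "m \<le> N * (1 - \<rho>)\<^sup>2 + 1" "1 \<le> m"
    and n: "N * \<rho>\<^sup>2 \<le> n" "n \<le> N * \<rho>\<^sup>2 + 1" "1 \<le> n"
begin

lemma flipped: "characteristic (1 - \<rho>) N t n m"
  using \<rho> t m n by unfold_locales auto

text \<open>
  The first order terms give the mean. The second order terms of the two axes, close to \<open>-N t\<^sup>2 / 2\<close>
  and \<open>N t\<^sup>2 / 2\<close>, cancel except for the contribution of the \<open>k\<close> columns that are missing. The third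
  order is bounded because \<open>N t\<^sup>3 = 1\<close>.
\<close>
lemma mgf_exponent:
  assumes k: "k \<le> m"
  shows "((\<rho> + t) / \<rho>) ^ n * ((1 - \<rho>) / (1 - \<rho> - t)) ^ (m - k) \<le>
    exp (t * (m / (1 - \<rho>) + n / \<rho>) - t * k / (1 - \<rho>) - t\<^sup>2 * k / (2 * (1 - \<rho>)\<^sup>2) + excess \<rho>)"
proof -
  define q where "q = 1 - \<rho>"
  define x where "x = t / \<rho>"
  define y where "y = t / q"
  have q: "0 < q" using \<rho> by (simp add: q_def)
  have x: "0 < x" and y: "0 < y" "y \<le> 1 / 2" using \<rho> t q by (auto simp: x_def y_def q_def)
  have t1: "t \<le> 1" using t \<rho> by simp
  have N: "N * t ^ 3 = 1" by (rule t)
  have "(\<rho> + t) / \<rho> = 1 + x" using \<rho> by (simp add: x_def field_simps)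
  moreover have "q / (q - t) = 1 / (1 - y)" using q t by (simp add: y_def q_def field_simps)
  moreover have "(1 + x) ^ n \<le> exp (x - x\<^sup>2 / 2 + x ^ 3 / 3) ^ n"
    using x by (intro power_mono one_plus_le_exp_cubic) auto
  moreover have "(1 / (1 - y)) ^ (m - k) \<le> exp (y + y\<^sup>2 / 2 + y ^ 3) ^ (m - k)"
    using y by (intro power_mono geometric_le_exp_cubic) auto
  ultimately have "((\<rho> + t) / \<rho>) ^ n * (q / (q - t)) ^ (m - k) \<le>
      exp (x - x\<^sup>2 / 2 + x ^ 3 / 3) ^ n * exp (y + y\<^sup>2 / 2 + y ^ 3) ^ (m - k)"
    using x y by (simp only:) (intro mult_mono; simp)
  also have "\<dots> = exp (n * (x - x\<^sup>2 / 2 + x ^ 3 / 3) + (m - k) * (y + y\<^sup>2 / 2 + y ^ 3))"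
    by (simp add: exp_of_nat_mult exp_add)
  also have "\<dots> \<le> exp (t * (m / q + n / \<rho>) - t * k / q - t\<^sup>2 * k / (2 * q\<^sup>2) + excess \<rho>)"
  proof -
    have a: "n * x = t * n / \<rho>" "m * y = t * m / q" "k * y = t * k / q" "k * y\<^sup>2 = t\<^sup>2 * k / q\<^sup>2"
      by (auto simp: x_def y_def power_divide)
    have "N * t\<^sup>2 = (N * \<rho>\<^sup>2) * x\<^sup>2" using \<rho> by (simp add: x_def power_divide)
    also have "\<dots> \<le> n * x\<^sup>2" using n by (intro mult_right_mono) auto
    finally have b: "N * t\<^sup>2 \<le> n * x\<^sup>2" .
    have "m * y\<^sup>2 \<le> (N * q\<^sup>2 + 1) * y\<^sup>2" using m by (intro mult_right_mono) (auto simp: q_def)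
    also have "\<dots> = N * t\<^sup>2 + t\<^sup>2 / q\<^sup>2" using q by (simp add: y_def power_divide field_simps)
    also have "\<dots> \<le> N * t\<^sup>2 + 1 / q\<^sup>2"
      using t1 t by (intro add_left_mono divide_right_mono) (auto simp: power_le_one)
    finally have c: "m * y\<^sup>2 \<le> N * t\<^sup>2 + 1 / q\<^sup>2" .
    have "n * x ^ 3 \<le> (N * \<rho>\<^sup>2 + 1) * x ^ 3" using n x by (intro mult_right_mono) auto
    also have "\<dots> = N * t ^ 3 / \<rho> + t ^ 3 / \<rho> ^ 3"
      using \<rho> by (simp add: x_def power_divide field_simps power2_eq_square power3_eq_cube)
    also have "\<dots> \<le> 1 / \<rho> + 1 / \<rho> ^ 3"
      using N t1 t \<rho> by (intro add_mono divide_right_mono) (auto simp: power_le_one)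
    finally have d: "n * x ^ 3 \<le> 1 / \<rho> + 1 / \<rho> ^ 3" .
    have "m * y ^ 3 \<le> (N * q\<^sup>2 + 1) * y ^ 3" using m y by (intro mult_right_mono) (auto simp: q_def)
    also have "\<dots> = N * t ^ 3 / q + t ^ 3 / q ^ 3"
      using q by (simp add: y_def power_divide field_simps power2_eq_square power3_eq_cube)
    also have "\<dots> \<le> 1 / q + 1 / q ^ 3"
      using N t1 t q by (intro add_mono divide_right_mono) (auto simp: power_le_one)
    finally have e: "m * y ^ 3 \<le> 1 / q + 1 / q ^ 3" .
    have f: "0 \<le> k * y ^ 3" "0 \<le> n * x ^ 3" "0 \<le> 1 / q\<^sup>2" "0 \<le> 1 / \<rho>\<^sup>2" using x y q \<rho> by auto
    have "n * (x - x\<^sup>2 / 2 + x ^ 3 / 3) + (m - k) * (y + y\<^sup>2 / 2 + y ^ 3) =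
        n * x - n * x\<^sup>2 / 2 + n * x ^ 3 / 3 + m * y - k * y + m * y\<^sup>2 / 2 - k * y\<^sup>2 / 2 + m * y ^ 3 - k * y ^ 3"
      using k by (simp add: of_nat_diff algebra_simps diff_divide_distrib add_divide_distrib)
    also have "\<dots> \<le> t * (m / q + n / \<rho>) - t * k / q - t\<^sup>2 * k / (2 * q\<^sup>2) + excess \<rho>"
    proof -
      have "t * (m / q + n / \<rho>) = t * m / q + t * n / \<rho>" "t\<^sup>2 * k / (2 * q\<^sup>2) = t\<^sup>2 * k / q\<^sup>2 / 2"
        by (simp_all add: algebra_simps)
      then show ?thesis using a b c d e f unfolding excess_def q_def[symmetric] by linarith
    qed
    finally show ?thesis using k by (simp add: of_nat_diff)
  qed
  finally show ?thesis by (simp add: q_def)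
qed

definition mean :: real where "mean = m / (1 - \<rho>) + n / \<rho>"

context
  fixes P :: "'a measure" and W
  assumes W: "stationary_weights P \<rho> W"
begin

lemma row_max_centred_mgf:
  assumes k: "k < m"
  shows "(\<integral>\<^sup>+x. ennreal (exp (t * row_max (\<lambda>s. W s x) (m - k) n - t * mean + t * k / (1 - \<rho>))) \<partial>P) \<le>
    ennreal (exp (excess \<rho> - t\<^sup>2 * k / (2 * (1 - \<rho>)\<^sup>2)))"
proof -
  let ?b = "- t * mean + t * k / (1 - \<rho>)"
  interpret prob_space P using W by (simp add: stationary_weights_iff)
  have [measurable]: "(\<lambda>x. row_max (\<lambda>s. W s x) (m - k) n) \<in> borel_measurable P"
    by (intro borel_measurable_row_max stationary_measurable[OF W]) (auto simp: sites_def)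
  have "(\<integral>\<^sup>+x. ennreal (exp (t * row_max (\<lambda>s. W s x) (m - k) n - t * mean + t * k / (1 - \<rho>))) \<partial>P) =
      (\<integral>\<^sup>+x. ennreal (exp ?b) * ennreal (exp (t * row_max (\<lambda>s. W s x) (m - k) n)) \<partial>P)"
    unfolding ennreal_mult'[OF exp_ge_zero, symmetric] mult_exp_exp by (simp add: algebra_simps)
  also have "\<dots> = ennreal (exp ?b) * (\<integral>\<^sup>+x. ennreal (exp (t * row_max (\<lambda>s. W s x) (m - k) n)) \<partial>P)"
    by (rule nn_integral_cmult) measurable
  also have "\<dots> \<le> ennreal (exp ?b) * ennreal (((\<rho> + t) / \<rho>) ^ n * ((1 - \<rho>) / (1 - \<rho> - t)) ^ (m - k))"
  proof (rule mult_left_mono)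
    have "t < 1 - \<rho>" "1 \<le> m - k" using t(1,4) k by simp_all
    then show "(\<integral>\<^sup>+x. ennreal (exp (t * row_max (\<lambda>s. W s x) (m - k) n)) \<partial>P) \<le>
        ennreal (((\<rho> + t) / \<rho>) ^ n * ((1 - \<rho>) / (1 - \<rho> - t)) ^ (m - k))"
      by (intro row_max_mgf W \<rho> t(1) n(3))
  qed simp
  also have "\<dots> \<le> ennreal (exp ?b) * ennreal (exp (t * (m / (1 - \<rho>) + n / \<rho>) - t * k / (1 - \<rho>) - t\<^sup>2 * k / (2 * (1 - \<rho>)\<^sup>2) + excess \<rho>))"
    using k by (intro mult_left_mono ennreal_leI mgf_exponent) auto
  also have "\<dots> = ennreal (exp (excess \<rho> - t\<^sup>2 * k / (2 * (1 - \<rho>)\<^sup>2)))"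
    unfolding ennreal_mult'[OF exp_ge_zero, symmetric] mult_exp_exp by (simp add: mean_def algebra_simps)
  finally show ?thesis .
qed

text \<open>
  Chernoff's bound with the exponent \<open>t / 64\<close>: this small multiple makes the quadratic term
  \<open>a / 512\<close> half of the linear gain \<open>a / 256\<close>.
\<close>
lemma passage_row_upper_tail:
  assumes a: "0 < a" and k: "t\<^sup>2 * k \<le> 8 * a * (1 - \<rho>)\<^sup>2"
  shows "measure P {x \<in> space P. t * k / (1 - \<rho>) + a / 4 \<le> t * passage (\<lambda>s. W s x) k 0} \<le> exp (- a / 512)"
proof -
  interpret prob_space P using W by (simp add: stationary_weights_iff)
  define q where "q = 1 - \<rho>"
  define \<theta> where "\<theta> = t / 64"
  define y where "y = \<theta> / q"
  have q: "0 < q" using \<rho> by (simp add: q_def)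
  have y: "0 < y" "y \<le> 1 / 2" using t q by (simp_all add: y_def \<theta>_def q_def)
  have th: "\<theta> < q" using t by (simp add: \<theta>_def q_def)
  have [measurable]: "(\<lambda>x. passage (\<lambda>s. W s x) k 0) \<in> borel_measurable P"
    by (intro borel_measurable_passage stationary_measurable[OF W])
  have "(\<integral>\<^sup>+x. ennreal (exp (\<theta> * passage (\<lambda>s. W s x) k 0 - \<theta> * k / q)) \<partial>P) =
      (\<integral>\<^sup>+x. ennreal (exp (- \<theta> * k / q)) * ennreal (exp (\<theta> * passage (\<lambda>s. W s x) k 0)) \<partial>P)"
    unfolding ennreal_mult'[OF exp_ge_zero, symmetric] mult_exp_exp by (simp add: algebra_simps)
  also have "\<dots> = ennreal (exp (- \<theta> * k / q)) * (\<integral>\<^sup>+x. ennreal (exp (\<theta> * passage (\<lambda>s. W s x) k 0)) \<partial>P)"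
    by (rule nn_integral_cmult) measurable
  also have "\<dots> = ennreal (exp (- \<theta> * k / q) * (q / (q - \<theta>)) ^ k)"
    unfolding passage_row_mgf[OF W \<rho>(2), of \<theta> k, folded q_def, OF th] by (rule ennreal_mult'[symmetric]) simp
  also have "\<dots> \<le> ennreal (exp (a / 512))"
  proof (rule ennreal_leI)
    have "q / (q - \<theta>) = 1 / (1 - y)" using q th by (simp add: y_def field_simps)
    then have "(q / (q - \<theta>)) ^ k \<le> exp (y + y\<^sup>2 / 2 + y ^ 3) ^ k"
      using y geometric_le_exp_cubic[of y] by (simp only:) (intro power_mono; simp)
    also have "\<dots> = exp (k * (y + y\<^sup>2 / 2 + y ^ 3))" by (simp add: exp_of_nat_mult)
    also have "\<dots> \<le> exp (k * (y + y\<^sup>2))"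
    proof -
      have "y ^ 3 \<le> y\<^sup>2 / 2" using y mult_left_mono[of y "1/2" "y\<^sup>2"]
        by (simp add: power2_eq_square power3_eq_cube)
      then show ?thesis by (simp add: mult_left_mono)
    qed
    finally have "exp (- \<theta> * k / q) * (q / (q - \<theta>)) ^ k \<le> exp (- \<theta> * k / q) * exp (k * (y + y\<^sup>2))"
      by (intro mult_left_mono) auto
    also have "\<dots> = exp (k * y\<^sup>2)" unfolding mult_exp_exp by (simp add: y_def algebra_simps)
    also have "k * y\<^sup>2 = t\<^sup>2 * k / (4096 * q\<^sup>2)" by (simp add: y_def \<theta>_def power_divide power_mult_distrib)
    also have "\<dots> \<le> 8 * a * q\<^sup>2 / (4096 * q\<^sup>2)"
      using k q by (intro divide_right_mono) (auto simp: q_def)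
    also have "\<dots> = a / 512" using q by simp
    finally show "exp (- \<theta> * k / q) * (q / (q - \<theta>)) ^ k \<le> exp (a / 512)" by simp
  qed
  finally have "prob {x \<in> space P. a / 256 \<le> \<theta> * passage (\<lambda>s. W s x) k 0 - \<theta> * k / q} \<le> exp (a / 512 - a / 256)"
    by (intro chernoff) auto
  moreover have "a / 256 \<le> \<theta> * u - \<theta> * k / q \<longleftrightarrow> t * k / (1 - \<rho>) + a / 4 \<le> t * u" for u
  proof -
    have lin: "a / 256 \<le> (c - d) / 64 \<longleftrightarrow> d + a / 4 \<le> c" for c d by (simp add: field_simps)
    have "\<theta> * u - \<theta> * k / q = (t * u - t * k / q) / 64" by (simp add: \<theta>_def diff_divide_distrib)
    then show ?thesis using lin unfolding q_def[symmetric] by (simp only:)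
  qed
  ultimately show ?thesis by simp
qed

end

text \<open>
  The passage time is the larger of the horizontal and the vertical maximum, and both obey the
  moment bound.
\<close>
lemma passage_centred_mgf:
  assumes W: "stationary_weights P \<rho> W"
  shows "(\<integral>\<^sup>+x. ennreal (exp (t * (passage (\<lambda>s. W s x) m n - mean))) \<partial>P) \<le> ennreal (2 * exp (excess \<rho>))"
proof -
  interpret fl: characteristic "1 - \<rho>" N t n m by (rule flipped)
  have mean: "fl.mean = mean" by (simp add: mean_def fl.mean_def)
  let ?X = "\<lambda>x. t * row_max (\<lambda>s. W s x) m n - t * mean"
  let ?Y = "\<lambda>x. t * row_max (flip (\<lambda>s. W s x)) n m - t * mean"
  have 1: "(\<integral>\<^sup>+x. ennreal (exp (?X x)) \<partial>P) \<le> ennreal (exp (excess \<rho>))"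
    using row_max_centred_mgf[OF W, of 0] m by simp
  have 2: "(\<integral>\<^sup>+x. ennreal (exp (?Y x)) \<partial>P) \<le> ennreal (exp (excess \<rho>))"
    using fl.row_max_centred_mgf[OF stationary_flip[OF W], of 0] n
    by (simp add: flip_fun mean excess_flip)
  \<comment> \<open>The sign of an optimal exit point decides which of the two maxima is attained.\<close>
  have "passage w m n = row_max w m n \<or> passage w m n = row_max (flip w) n m" for w
  proof -
    obtain j where j: "exits w (int m, int n) j" using exits_exists m n by blast
    show ?thesis
    proof (cases "j > 0")
      case True
      then show ?thesis using exits_row_max[of n "nat j" w m] j n by simp
    next
      case False
      have "j \<noteq> 0" using j by (auto simp: exits_def)
      then show ?thesis
        using exits_row_max[of m "nat (- j)" "flip w" n] exits_flip[of m n w j] j m n False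
        by (simp add: passage_flip)
    qed
  qed
  then have "exp (t * (passage w m n - mean)) \<le>
      exp (t * row_max w m n - t * mean) + exp (t * row_max (flip w) n m - t * mean)" for w
    by (metis add_increasing add_increasing2 exp_ge_zero order_refl right_diff_distrib)
  then have "(\<integral>\<^sup>+x. ennreal (exp (t * (passage (\<lambda>s. W s x) m n - mean))) \<partial>P) \<le>
      (\<integral>\<^sup>+x. ennreal (exp (?X x)) + ennreal (exp (?Y x)) \<partial>P)"
    by (intro nn_integral_mono) (simp add: ennreal_plus[symmetric] del: ennreal_plus)
  also have "\<dots> = (\<integral>\<^sup>+x. ennreal (exp (?X x)) \<partial>P) + (\<integral>\<^sup>+x. ennreal (exp (?Y x)) \<partial>P)"
  proof (rule nn_integral_add)
    have "(\<lambda>x. row_max (\<lambda>s. W s x) m n) \<in> borel_measurable P"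
      "(\<lambda>x. row_max (\<lambda>s. flip W s x) n m) \<in> borel_measurable P"
      by (intro borel_measurable_row_max stationary_measurable[OF W]
          stationary_measurable[OF stationary_flip[OF W]]; simp add: sites_def)+
    note [measurable] = this[unfolded flip_fun]
    show "(\<lambda>x. ennreal (exp (?X x))) \<in> borel_measurable P"
      "(\<lambda>x. ennreal (exp (?Y x))) \<in> borel_measurable P" by measurable
  qed
  also have "\<dots> \<le> ennreal (exp (excess \<rho>)) + ennreal (exp (excess \<rho>))"
    by (rule add_mono[OF 1 2])
  also have "\<dots> = ennreal (2 * exp (excess \<rho>))" by (simp add: ennreal_plus[symmetric] del: ennreal_plus)
  finally show ?thesis .
qed

lemma passage_lower_tail:
  assumes W: "stationary_weights P \<rho> W" and b: "0 < b"
  shows "measure P {x \<in> space P. t * (passage (\<lambda>s. W s x) m n - mean) \<le> - b} \<le> 2 * exp (excess \<rho>) / b"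
proof -
  interpret prob_space P using W by (simp add: stationary_weights_iff)
  note H = passage_mean[OF W \<rho>, of m n, folded mean_def]
  show ?thesis
  proof (rule centred_lower_tail[OF _ _ passage_centred_mgf[OF W] _ b])
    show "integrable P (\<lambda>x. t * (passage (\<lambda>s. W s x) m n - mean))"
      using H(1) by (intro integrable_mult_right Bochner_Integration.integrable_diff integrable_const)
    show "expectation (\<lambda>x. t * (passage (\<lambda>s. W s x) m n - mean)) = 0"
      using H by (simp add: prob_space)
  qed simp
qed

text \<open>
  An exit beyond \<open>k\<close> splits the passage time into the first \<open>k\<close> boundary weights and the horizontal
  maximum from the base point \<open>(k, 0)\<close>. In units of \<open>1 / t\<close> the latter typically falls short by a
  multiple of \<open>a\<close>, so one of three rare events must occur: the maximum is large, the sum of the weights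
  is large, or the passage time is small.
\<close>
lemma far_exit_prob:
  fixes k :: nat
  assumes W: "stationary_weights P \<rho> W" and a: "0 < a"
    and k: "4 * a * (1 - \<rho>)\<^sup>2 \<le> t\<^sup>2 * k" "t\<^sup>2 * k \<le> 8 * a * (1 - \<rho>)\<^sup>2"
  shows "measure P {x \<in> space P. \<exists>j>k. exits (\<lambda>s. W s x) (int m, int n) (int j)} \<le>
    exp (excess \<rho> - a) + exp (- a / 512) + 4 * exp (excess \<rho>) / a"
proof (cases "k < m")
  case False
  have "\<not> exits (\<lambda>s. W s x) (int m, int n) (int j)" if "k < j" for j x
    using exits_shift_iter(2)[OF n(3) that] False by metis
  then have none: "{x \<in> space P. \<exists>j>k. exits (\<lambda>s. W s x) (int m, int n) (int j)} = {}"
    by auto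
  show ?thesis unfolding none using a by simp
next
  case True
  interpret prob_space P using W by (simp add: stationary_weights_iff)
  let ?Wk = "\<lambda>z x. (shift ^^ k) (\<lambda>s. W s x) z"
  note Wk = stationary_shift_iter[OF W \<rho>, of k]
  let ?low = "{x \<in> space P. t * (passage (\<lambda>s. W s x) m n - mean) \<le> - (a / 2)}"
  let ?row = "{x \<in> space P. t * k / (1 - \<rho>) + a / 4 \<le> t * passage (\<lambda>s. W s x) k 0}"
  let ?max = "{x \<in> space P. - (3 * a / 4) \<le> t * row_max (\<lambda>s. ?Wk s x) (m - k) n - t * mean + t * k / (1 - \<rho>)}"
  have [measurable]: "(\<lambda>x. passage (\<lambda>s. W s x) i j) \<in> borel_measurable P" for i j
    by (intro borel_measurable_passage stationary_measurable[OF W])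
  have [measurable]: "(\<lambda>x. row_max (\<lambda>s. ?Wk s x) (m - k) n) \<in> borel_measurable P"
    by (intro borel_measurable_row_max stationary_measurable[OF Wk]) (auto simp: sites_def)
  have "{x \<in> space P. \<exists>j>k. exits (\<lambda>s. W s x) (int m, int n) (int j)} \<subseteq> ?max \<union> ?row \<union> ?low"
  proof
    fix x assume "x \<in> {x \<in> space P. \<exists>j>k. exits (\<lambda>s. W s x) (int m, int n) (int j)}"
    then obtain j where x: "x \<in> space P" and j: "k < j" "exits (\<lambda>s. W s x) (int m, int n) (int j)" by blast
    let ?w = "\<lambda>s. W s x"
    have "passage ((shift ^^ k) ?w) (m - k) n = row_max ((shift ^^ k) ?w) (m - k) n"
      by (rule exits_row_max[OF n(3) _ exits_shift_iter(1)[OF n(3) j]]) (use j in simp)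
    then have eq: "passage ?w m n = passage ?w k 0 + row_max ((shift ^^ k) ?w) (m - k) n"
      using True by (simp add: passage_shift_iter)
    \<comment> \<open>The thresholds \<open>- 3 a / 4\<close>, \<open>a / 4\<close> and \<open>- a / 2\<close> of the three events balance exactly.\<close>
    show "x \<in> ?max \<union> ?row \<union> ?low"
    proof (rule ccontr)
      assume "x \<notin> ?max \<union> ?row \<union> ?low"
      then have "t * (passage ?w m n - mean) > - (a / 2)" "t * passage ?w k 0 < t * k / (1 - \<rho>) + a / 4"
        "t * row_max ((shift ^^ k) ?w) (m - k) n - t * mean + t * k / (1 - \<rho>) < - (3 * a / 4)"
        using x by auto
      then show False unfolding eq by (simp add: algebra_simps)
    qed
  qed
  then have "prob {x \<in> space P. \<exists>j>k. exits (\<lambda>s. W s x) (int m, int n) (int j)} \<le> prob (?max \<union> ?row \<union> ?low)"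
    by (rule finite_measure_mono) measurable
  also have "\<dots> \<le> prob (?max \<union> ?row) + prob ?low"
    by (rule measure_Un_le) measurable
  also have "\<dots> \<le> prob ?max + prob ?row + prob ?low"
    by (intro add_right_mono measure_Un_le) measurable
  also have "prob ?max \<le> exp ((excess \<rho> - t\<^sup>2 * k / (2 * (1 - \<rho>)\<^sup>2)) - - (3 * a / 4))"
    by (rule chernoff[OF _ row_max_centred_mgf[OF Wk True]]) measurable
  also have "\<dots> \<le> exp (excess \<rho> - a)"
  proof -
    have "2 * a = 4 * a * (1 - \<rho>)\<^sup>2 / (2 * (1 - \<rho>)\<^sup>2)" using \<rho> by simp
    also have "\<dots> \<le> t\<^sup>2 * k / (2 * (1 - \<rho>)\<^sup>2)" using k by (intro divide_right_mono) auto
    finally show ?thesis using a by simp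
  qed
  also have "prob ?row \<le> exp (- a / 512)"
    by (rule passage_row_upper_tail[OF W a k(2)])
  also have "prob ?low \<le> 2 * exp (excess \<rho>) / (a / 2)"
    by (rule passage_lower_tail[OF W]) (use a in simp)
  finally show ?thesis by simp
qed

end

section \<open>Blocks\<close>

text \<open>
  The base point moves to the start of the block of length \<open>L\<close> that contains \<open>j\<close>; blocks start
  after multiples of \<open>L\<close>, hence \<open>j - 1\<close>. The second coordinate of the endpoint is unchanged
  and keeps it outside the rectangle.
\<close>
lemma near_of_exits:
  assumes ex: "exits w (int m, int n) (int j)" and j: "1 \<le> j" and L: "1 \<le> L" "real L \<le> l"
    and n: "1 \<le> n" "snd v < int n"
  shows "near v l ((shift ^^ ((j - 1) div L * L)) w)"
proof -
  define k where "k = (j - 1) div L * L"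
  have "k \<le> j - 1" "j - 1 < L + k"
    using L dividend_less_times_div[of L "j - 1"] unfolding k_def by (auto simp: mult.commute)
  then have k: "k < j" "j - k \<le> L" using j by auto
  have e: "exits ((shift ^^ k) w) (int (m - k), int n) (int (j - k))" and km: "k < m"
    using exits_shift_iter[OF n(1) k(1) ex] .
  have "(int (m - k), int n) \<in> bulk - {0..v}"
    using km n by (auto simp: bulk_def less_eq_prod_def)
  moreover have "real_of_int \<bar>int (j - k)\<bar> \<le> l" using k(2) L by simp
  ultimately show ?thesis using e unfolding near_def k_def[symmetric] by blast
qed

lemma near_of_exits_neg:
  assumes ex: "exits w (int m, int n) (- int j)" and j: "1 \<le> j" and L: "1 \<le> L" "real L \<le> l"
    and m: "1 \<le> m" "fst v < int m" and n: "1 \<le> n"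
  shows "near v l (flip ((shift ^^ ((j - 1) div L * L)) (flip w)))"
proof -
  let ?k = "(j - 1) div L * L"
  have "exits (flip w) (int n, int m) (int j)"
    using exits_flip[OF m(1) n, of w "- int j"] ex by simp
  from near_of_exits[OF this j L m(1), of "prod.swap v"]
  obtain z i where z: "z \<in> bulk" "z \<notin> {0..prod.swap v}" "real_of_int \<bar>i\<bar> \<le> l"
      "exits ((shift ^^ ?k) (flip w)) z i"
    using m(2) by (auto simp: near_def)
  obtain a b where ab: "z = (int a, int b)" "1 \<le> a" "1 \<le> b" using z(1) by (rule bulkE)
  have "exits (flip ((shift ^^ ?k) (flip w))) (int b, int a) (- i)"
    using exits_flip[of a b "(shift ^^ ?k) (flip w)" i] ab z by simp
  moreover have "(int b, int a) \<in> bulk - {0..v}"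
    using z ab by (cases v) (auto simp: bulk_def less_eq_prod_def)
  ultimately show ?thesis using z(3) unfolding near_def by (intro bexI[of _ "(int b, int a)"] exI[of _ "- i"]) auto
qed

text \<open>
  Every block contributes at most the probability of \<open>near\<close>, because the shifted models have the
  same law.
\<close>
lemma prob_exits_window_le:
  assumes W: "stationary_weights P \<rho> W" and \<rho>: "0 < \<rho>" "\<rho> < 1"
    and L: "1 \<le> L" "real L \<le> l" and mn: "1 \<le> m" "1 \<le> n" and v: "fst v < int m" "snd v < int n"
  shows "measure P {x \<in> space P. \<exists>j. \<bar>j\<bar> \<le> int K \<and> exits (\<lambda>s. W s x) (int m, int n) j} \<le>
    2 * (real (K div L) + 1) * measure P {x \<in> space P. near v l (\<lambda>s. W s x)}"
proof -
  interpret prob_space P using W by (simp add: stationary_weights_iff)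
  define p where "p = prob {x \<in> space P. near v l (\<lambda>s. W s x)}"
  define A where "A i = {x \<in> space P. near v l (\<lambda>z. (shift ^^ (i * L)) (\<lambda>s. W s x) z)}" for i
  define B where "B i = {x \<in> space P. near v l (\<lambda>z. flip ((shift ^^ (i * L)) (flip (\<lambda>s. W s x))) z)}" for i
  have stA: "stationary_weights P \<rho> (\<lambda>z x. (shift ^^ k) (\<lambda>s. W s x) z)" for k
    by (rule stationary_shift_iter[OF W \<rho>])
  note stB = stationary_top_row[OF W \<rho>]
  have A: "A i \<in> events" "prob (A i) = p" for i
    unfolding A_def p_def
    using sets_near[OF stationary_measurable[OF stA]] prob_near_law[OF stA] prob_near_law[OF W] by auto
  have B: "B i \<in> events" "prob (B i) = p" for i
    unfolding B_def p_def
    using sets_near[OF stationary_measurable[OF stB]] prob_near_law[OF stB] prob_near_law[OF W] by auto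
  have "{x \<in> space P. \<exists>j. \<bar>j\<bar> \<le> int K \<and> exits (\<lambda>s. W s x) (int m, int n) j} \<subseteq>
      (\<Union>i\<in>{..K div L}. A i) \<union> (\<Union>i\<in>{..K div L}. B i)"
  proof
    fix x assume "x \<in> {x \<in> space P. \<exists>j. \<bar>j\<bar> \<le> int K \<and> exits (\<lambda>s. W s x) (int m, int n) j}"
    then obtain j where x: "x \<in> space P" and j: "\<bar>j\<bar> \<le> int K" "exits (\<lambda>s. W s x) (int m, int n) j" by blast
    define i where "i = nat \<bar>j\<bar>"
    have "j \<noteq> 0" using j(2) by (auto simp: exits_def)
    then have i: "1 \<le> i" "i \<le> K" "j = int i \<or> j = - int i" using j(1) by (auto simp: i_def)
    have le: "(i - 1) div L \<le> K div L" using i by (intro div_le_mono) auto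
    from i(3) show "x \<in> (\<Union>i\<in>{..K div L}. A i) \<union> (\<Union>i\<in>{..K div L}. B i)"
    proof
      assume "j = int i"
      then have "x \<in> A ((i - 1) div L)"
        using near_of_exits[OF _ i(1) L mn(2) v(2)] j(2) x unfolding A_def by auto
      then show ?thesis using le by blast
    next
      assume "j = - int i"
      then have "x \<in> B ((i - 1) div L)"
        using near_of_exits_neg[OF _ i(1) L mn(1) v(1) mn(2)] j(2) x unfolding B_def by auto
      then show ?thesis using le by blast
    qed
  qed
  then have "prob {x \<in> space P. \<exists>j. \<bar>j\<bar> \<le> int K \<and> exits (\<lambda>s. W s x) (int m, int n) j} \<le>
      prob ((\<Union>i\<in>{..K div L}. A i) \<union> (\<Union>i\<in>{..K div L}. B i))"
    using A B by (intro finite_measure_mono) auto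
  also have "\<dots> \<le> prob (\<Union>i\<in>{..K div L}. A i) + prob (\<Union>i\<in>{..K div L}. B i)"
    using A B by (intro measure_Un_le) auto
  also have "\<dots> \<le> (\<Sum>i\<in>{..K div L}. prob (A i)) + (\<Sum>i\<in>{..K div L}. prob (B i))"
    using A B by (intro add_mono finite_measure_subadditive_finite) auto
  also have "\<dots> = 2 * (real (K div L) + 1) * p"
    using A B by (simp add: algebra_simps)
  finally show ?thesis by (simp add: p_def)
qed

lemma (in prob_space) prob_cover_three:
  assumes "A \<in> events" "B \<in> events" "C \<in> events" "space M \<subseteq> A \<union> B \<union> C"
  shows "1 \<le> prob A + prob B + prob C"
proof -
  have "1 \<le> prob (A \<union> B \<union> C)"
    using finite_measure_mono[of "space M" "A \<union> B \<union> C"] assms by (simp add: prob_space)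
  also have "\<dots> \<le> prob (A \<union> B) + prob C" using assms by (intro measure_Un_le) auto
  also have "\<dots> \<le> prob A + prob B + prob C" using assms by (intro add_right_mono measure_Un_le) auto
  finally show ?thesis .
qed

context characteristic
begin

text \<open>
  The cut-offs on the two axes differ, since the far exits are controlled in terms of \<open>1 - \<rho>\<close> on
  one axis and \<open>\<rho>\<close> on the other, but both are of order \<open>a / t\<^sup>2 = a N\<^bsup>2/3\<^esup>\<close>.
\<close>
lemma exits_window_prob:
  assumes W: "stationary_weights P \<rho> W"
    and a: "0 < a" "1 \<le> 4 * a * (1 - \<rho>)\<^sup>2" "1 \<le> 4 * a * \<rho>\<^sup>2"
    and small: "exp (excess \<rho> - a) + exp (- a / 512) + 4 * exp (excess \<rho>) / a \<le> 1 / 4"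
  shows "1 / 2 \<le> measure P {x \<in> space P. \<exists>j. \<bar>j\<bar> \<le> int (nat \<lfloor>8 * a / t\<^sup>2\<rfloor>) \<and> exits (\<lambda>s. W s x) (int m, int n) j}"
proof -
  interpret prob_space P using W by (simp add: stationary_weights_iff)
  interpret fl: characteristic "1 - \<rho>" N t n m by (rule flipped)
  let ?K = "nat \<lfloor>8 * a / t\<^sup>2\<rfloor>"
  have t2: "0 < t\<^sup>2" "t\<^sup>2 \<le> 1" using t(1,3) \<rho> by (auto simp: power_le_one)
  have ex: "\<exists>k. 4 * a * c\<^sup>2 \<le> t\<^sup>2 * real k \<and> t\<^sup>2 * real k \<le> 8 * a * c\<^sup>2 \<and> k \<le> ?K"
    if c: "0 < c" "c < 1" "1 \<le> 4 * a * c\<^sup>2" for c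
  proof -
    define k where "k = nat \<lceil>4 * a * c\<^sup>2 / t\<^sup>2\<rceil>"
    have pos: "0 \<le> 4 * a * c\<^sup>2 / t\<^sup>2" using a by simp
    have k: "4 * a * c\<^sup>2 / t\<^sup>2 \<le> real k" "real k \<le> 4 * a * c\<^sup>2 / t\<^sup>2 + 1"
      unfolding k_def using pos by linarith+
    have 1: "4 * a * c\<^sup>2 \<le> t\<^sup>2 * real k" using k(1) t2 by (simp add: field_simps)
    have "t\<^sup>2 * real k \<le> t\<^sup>2 * (4 * a * c\<^sup>2 / t\<^sup>2 + 1)" using k(2) t2 by (intro mult_left_mono) auto
    also have "\<dots> = 4 * a * c\<^sup>2 + t\<^sup>2" using t2 by (simp add: distrib_left)
    also have "\<dots> \<le> 8 * a * c\<^sup>2" using t2 c by linarith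
    finally have 2: "t\<^sup>2 * real k \<le> 8 * a * c\<^sup>2" .
    have "8 * a * c\<^sup>2 \<le> 8 * a * 1" using c a by (intro mult_left_mono) (auto simp: power_le_one)
    then have "real k \<le> 8 * a / t\<^sup>2" using 2 t2 by (simp add: field_simps)
    then have "k \<le> ?K" by (simp add: le_nat_floor)
    then show ?thesis using 1 2 by blast
  qed
  obtain k1 where k1: "4 * a * (1 - \<rho>)\<^sup>2 \<le> t\<^sup>2 * real k1" "t\<^sup>2 * real k1 \<le> 8 * a * (1 - \<rho>)\<^sup>2" "k1 \<le> ?K"
    using ex[of "1 - \<rho>"] \<rho> a by auto
  obtain k2 where k2: "4 * a * \<rho>\<^sup>2 \<le> t\<^sup>2 * real k2" "t\<^sup>2 * real k2 \<le> 8 * a * \<rho>\<^sup>2" "k2 \<le> ?K"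
    using ex[of \<rho>] \<rho> a by auto
  let ?E = "{x \<in> space P. \<exists>j. \<bar>j\<bar> \<le> int ?K \<and> exits (\<lambda>s. W s x) (int m, int n) j}"
  let ?R = "{x \<in> space P. \<exists>j>k1. exits (\<lambda>s. W s x) (int m, int n) (int j)}"
  let ?U = "{x \<in> space P. \<exists>j>k2. exits (\<lambda>s. flip W s x) (int n, int m) (int j)}"
  have R: "prob ?R \<le> 1 / 4" using far_exit_prob[OF W a(1) k1(1,2)] small by linarith
  have U: "prob ?U \<le> 1 / 4"
  proof -
    have "4 * a * (1 - (1 - \<rho>))\<^sup>2 \<le> t\<^sup>2 * real k2" "t\<^sup>2 * real k2 \<le> 8 * a * (1 - (1 - \<rho>))\<^sup>2"
      using k2(1,2) by simp_all
    from fl.far_exit_prob[OF stationary_flip[OF W] a(1) this] small show ?thesis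
      unfolding excess_flip by linarith
  qed
  have bulk: "(int m, int n) \<in> bulk" "(int n, int m) \<in> bulk" using m n by (auto simp: bulk_def)
  have sets: "?E \<in> events" "?R \<in> events" "?U \<in> events"
  proof -
    have "(\<Union>j\<in>{j. \<bar>j\<bar> \<le> int ?K}. {x \<in> space P. exits (\<lambda>s. W s x) (int m, int n) j}) \<in> events"
      by (intro sets.countable_UN'' sets_exits[OF bulk(1)] stationary_measurable[OF W] countableI_type)
    also have "(\<Union>j\<in>{j. \<bar>j\<bar> \<le> int ?K}. {x \<in> space P. exits (\<lambda>s. W s x) (int m, int n) j}) = ?E" by blast
    finally show "?E \<in> events" .
    have "(\<Union>j\<in>{k1<..}. {x \<in> space P. exits (\<lambda>s. W s x) (int m, int n) (int j)}) \<in> events"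
      by (intro sets.countable_UN'' sets_exits[OF bulk(1)] stationary_measurable[OF W] countableI_type)
    also have "(\<Union>j\<in>{k1<..}. {x \<in> space P. exits (\<lambda>s. W s x) (int m, int n) (int j)}) = ?R" by blast
    finally show "?R \<in> events" .
    have "(\<Union>j\<in>{k2<..}. {x \<in> space P. exits (\<lambda>s. flip W s x) (int n, int m) (int j)}) \<in> events"
      by (intro sets.countable_UN'' sets_exits[OF bulk(2)] stationary_measurable[OF stationary_flip[OF W]]
          countableI_type)
    also have "(\<Union>j\<in>{k2<..}. {x \<in> space P. exits (\<lambda>s. flip W s x) (int n, int m) (int j)}) = ?U" by blast
    finally show "?U \<in> events" .
  qed
  have "space P \<subseteq> ?E \<union> ?R \<union> ?U"
  proof
    fix x assume x: "x \<in> space P"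
    obtain j where j: "exits (\<lambda>s. W s x) (int m, int n) j" using exits_exists m(3) n(3) by blast
    consider "\<bar>j\<bar> \<le> int ?K" | "int ?K < j" | "j < - int ?K" by linarith
    then show "x \<in> ?E \<union> ?R \<union> ?U"
    proof cases
      case 2
      have "int k1 \<le> int ?K" using k1(3) by (simp only: of_nat_le_iff)
      then have "int k1 < j" using 2 by (rule le_less_trans)
      then have "nat j > k1" "int (nat j) = j" by linarith+
      then have "nat j > k1" "exits (\<lambda>s. W s x) (int m, int n) (int (nat j))" using j by simp_all
      then show ?thesis using x by blast
    next
      case 3
      have "int k2 \<le> int ?K" using k2(3) by (simp only: of_nat_le_iff)
      also have "\<dots> < - j" using 3 by linarith
      finally have "nat (- j) > k2" "int (nat (- j)) = - j" by linarith+
      then have "nat (- j) > k2" "exits (\<lambda>s. flip W s x) (int n, int m) (int (nat (- j)))"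
        using j exits_flip[OF m(3) n(3), of "\<lambda>s. W s x" j] by (simp_all add: flip_fun)
      then show ?thesis using x by blast
    qed (use x j in blast)
  qed
  from prob_cover_three[OF sets this] show ?thesis using R U by linarith
qed

end

lemma tail_bound_vanishes:
  fixes C :: real
  shows "((\<lambda>a. exp (C - a) + exp (- a / 512) + 4 * exp C / a) \<longlongrightarrow> 0) at_top"
proof -
  have "filterlim (\<lambda>a. - C + a) at_top at_top"
    by (rule filterlim_tendsto_add_at_top[OF tendsto_const filterlim_ident])
  then have "filterlim (\<lambda>a. - (- C + a)) at_bot at_top"
    by (simp only: filterlim_uminus_at_bot minus_minus)
  then have "((\<lambda>a. exp (- (- C + a))) \<longlongrightarrow> 0) at_top"
    by (rule filterlim_compose[OF exp_at_bot])
  moreover have "filterlim (\<lambda>a::real. 1 / 512 * a) at_top at_top"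
    by (rule filterlim_tendsto_pos_mult_at_top[OF tendsto_const _ filterlim_ident]) simp
  then have "filterlim (\<lambda>a::real. - (1 / 512 * a)) at_bot at_top"
    by (simp only: filterlim_uminus_at_bot minus_minus)
  then have "((\<lambda>a::real. exp (- (1 / 512 * a))) \<longlongrightarrow> 0) at_top"
    by (rule filterlim_compose[OF exp_at_bot])
  moreover have "((\<lambda>a. 4 * exp C / a) \<longlongrightarrow> 0) at_top"
    by (intro tendsto_divide_0[OF tendsto_const] filterlim_at_top_imp_at_infinity filterlim_ident)
  ultimately show ?thesis by (auto intro!: tendsto_add_zero)
qed

theorem theorem4p4:
  fixes \<rho> :: real
  assumes "0 < \<rho>" and "\<rho> < 1"
  shows "\<exists>\<delta>\<^sub>0>0. \<exists>C>0. \<exists>N\<^sub>0>0. \<forall>(P :: 'a measure) W. stationary_weights P \<rho> W \<longrightarrow>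
    (\<forall>(N::real) (\<delta>::real). N \<ge> N\<^sub>0 \<longrightarrow> N powr (-2/3) \<le> \<delta> \<longrightarrow> \<delta> \<le> \<delta>\<^sub>0 \<longrightarrow>
      \<P>(x in P. \<exists>z \<in> bulk - {0..vN \<rho> N}.
          real_of_int \<bar>exit_time (\<lambda>s. W s x) z\<bar> \<le> \<delta> * N powr (2/3)) \<ge> C * \<delta>)"
proof -
  have "\<forall>\<^sub>F a in at_top. exp (excess \<rho> - a) + exp (- a / 512) + 4 * exp (excess \<rho>) / a < 1 / 4"
    by (rule order_tendstoD(2)[OF tail_bound_vanishes]) simp
  moreover have "\<forall>\<^sub>F a::real in at_top. max 1 (max (1 / (4 * (1 - \<rho>)\<^sup>2)) (1 / (4 * \<rho>\<^sup>2))) \<le> a"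
    by (rule eventually_ge_at_top)
  ultimately obtain a where small: "exp (excess \<rho> - a) + exp (- a / 512) + 4 * exp (excess \<rho>) / a < 1 / 4"
    and amax: "max 1 (max (1 / (4 * (1 - \<rho>)\<^sup>2)) (1 / (4 * \<rho>\<^sup>2))) \<le> a"
    using eventually_happens'[OF trivial_limit_at_top_linorder eventually_conj] by fastforce
  have a: "1 \<le> a" "1 \<le> 4 * a * (1 - \<rho>)\<^sup>2" "1 \<le> 4 * a * \<rho>\<^sup>2"
    using amax assms by (auto simp: field_simps)
  \<comment> \<open>Chosen so that \<open>N \<ge> r powr (-3)\<close> gives \<open>t \<le> r\<close>, as the locale requires.\<close>
  define r where "r = min \<rho> (1 - \<rho>) / 2"
  have r: "0 < r" "r < 1" "r \<le> \<rho> / 2" "r \<le> (1 - \<rho>) / 2" using assms by (auto simp: r_def)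
  define C where "C = 1 / (4 * (16 * a + 1))"
  have "C * \<delta> \<le> \<P>(x in P. \<exists>z \<in> bulk - {0..vN \<rho> N}.
          real_of_int \<bar>exit_time (\<lambda>s. W s x) z\<bar> \<le> \<delta> * N powr (2/3))"
    if W: "stationary_weights P \<rho> W" and N: "N \<ge> r powr (-3)" and \<delta>: "N powr (-2/3) \<le> \<delta>" "\<delta> \<le> 1"
    for P :: "'a measure" and W and N \<delta> :: real
  proof -
    have "0 < r powr (-3)" using r by simp
    then have N0: "0 < N" using N by linarith
    define t where "t = N powr (-1/3)"
    have t0: "0 < t" using N0 by (simp add: t_def)
    have t3: "t ^ 3 = 1 / N" "t\<^sup>2 = N powr (-2/3)"
      using N0 by (simp_all add: t_def powr_powr flip: powr_realpow) (simp_all add: powr_minus_divide)?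
    have "t \<le> (r powr (-3)) powr (-1/3)"
      unfolding t_def using N r by (intro powr_mono2') auto
    also have "\<dots> = r" using r by (simp add: powr_powr)
    finally have tr: "t \<le> r" .
    \<comment> \<open>One step beyond \<open>vN\<close> in both coordinates, so that either coordinate alone keeps the endpoint outside.\<close>
    define m where "m = nat (\<lfloor>N * (1 - \<rho>)\<^sup>2\<rfloor> + 1)"
    define n where "n = nat (\<lfloor>N * \<rho>\<^sup>2\<rfloor> + 1)"
    have pos: "0 \<le> N * (1 - \<rho>)\<^sup>2" "0 \<le> N * \<rho>\<^sup>2" using N0 by auto
    have m: "N * (1 - \<rho>)\<^sup>2 \<le> m" "m \<le> N * (1 - \<rho>)\<^sup>2 + 1" "1 \<le> m" "\<lfloor>N * (1 - \<rho>)\<^sup>2\<rfloor> < int m"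
      unfolding m_def using pos(1) by linarith+
    have n: "N * \<rho>\<^sup>2 \<le> n" "n \<le> N * \<rho>\<^sup>2 + 1" "1 \<le> n" "\<lfloor>N * \<rho>\<^sup>2\<rfloor> < int n"
      unfolding n_def using pos(2) by linarith+
    note vN_less = m(4) n(4)
    interpret characteristic \<rho> N t m n
      using assms t0 t3 N0 tr r m n by unfold_locales auto
    define M where "M = N powr (2/3)"
    have M: "0 < M" "M = 1 / t\<^sup>2" using N0 by (simp_all add: M_def t3 powr_minus_divide)
    have "t\<^sup>2 * M \<le> \<delta> * M" using \<delta>(1) M(1) unfolding t3(2) by (intro mult_right_mono) auto
    then have \<delta>M: "1 \<le> \<delta> * M" using M(2) t0 by simp
    have \<delta>0: "0 < \<delta>" using \<delta>(1) N0 by (smt (verit) powr_gt_zero)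
    define L where "L = nat \<lfloor>\<delta> * M\<rfloor>"
    have "1 \<le> \<lfloor>\<delta> * M\<rfloor>" using \<delta>M by simp
    then have L: "1 \<le> L" "real L \<le> \<delta> * M" "\<delta> * M / 2 \<le> real L" unfolding L_def by linarith+
    define K where "K = nat \<lfloor>8 * a / t\<^sup>2\<rfloor>"
    let ?p = "measure P {x \<in> space P. near (vN \<rho> N) (\<delta> * M) (\<lambda>s. W s x)}"
    have K: "real K \<le> 8 * a * M"
      unfolding K_def M(2) using a t0 by (simp add: of_nat_floor)
    have "real (K div L) \<le> real K / real L" by (rule of_nat_div_le_of_nat)
    also have "\<dots> \<le> (8 * a * M) / (\<delta> * M / 2)"
      using K L a M \<delta>0 by (intro frac_le) auto
    also have "\<dots> = 16 * a / \<delta>" using M(1) \<delta>0 by (simp add: field_simps)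
    finally have KL: "real (K div L) \<le> 16 * a / \<delta>" .
    have "1 / 2 \<le> measure P {x \<in> space P. \<exists>j. \<bar>j\<bar> \<le> int K \<and> exits (\<lambda>s. W s x) (int m, int n) j}"
      unfolding K_def using a small by (intro exits_window_prob[OF W]) auto
    also have "\<dots> \<le> 2 * (real (K div L) + 1) * ?p"
      using m(3) n(3) vN_less by (intro prob_exits_window_le[OF W assms L(1,2)]) (auto simp: vN_def)
    also have "\<dots> \<le> 2 * (16 * a / \<delta> + 1 / \<delta>) * ?p"
      using KL \<delta> \<delta>0 by (intro mult_right_mono mult_left_mono add_mono) auto
    also have "\<dots> = 2 * (16 * a + 1) * ?p / \<delta>" by (simp add: add_divide_distrib algebra_simps)
    finally have "\<delta> / 2 \<le> 2 * (16 * a + 1) * ?p" using \<delta>0 by (simp add: pos_le_divide_eq)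
    then have "\<delta> \<le> ?p * (4 * (16 * a + 1))" by (simp add: algebra_simps)
    then have "C * \<delta> \<le> ?p" using a by (simp add: C_def pos_divide_le_eq)
    also have "?p \<le> \<P>(x in P. \<exists>z \<in> bulk - {0..vN \<rho> N}. real_of_int \<bar>exit_time (\<lambda>s. W s x) z\<bar> \<le> \<delta> * N powr (2/3))"
      using prob_near_le[OF W] unfolding M_def .
    finally show ?thesis .
  qed
  moreover have "0 < C" "0 < r powr (-3)" using a r by (auto simp: C_def)
  ultimately show ?thesis
    by (intro exI[of _ 1] exI[of _ C] exI[of _ "r powr (-3)"] conjI allI impI) auto
qed

end
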